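(* Let $p\in\mathbb{N}$, $k\in[p]=\{1,\dots,p\}$, $M>0$, and let $(\mathcal{J}_0,\mathcal{J}_1,\mathcal{J}_f)$ be a partition of $[p]$ with $|\mathcal{J}_1|\le k$. Let $$g_{\mathcal{N}}(\beta):=\inf_{z\in\mathbb{R}^p}\Big\{\tfrac12\sum_{j\in[p]}\beta_j^2/z_j\ :\ (\beta,z)\in\mathcal{D}\Big\},$$ where $\mathcal{D}$ is the set of $(\beta,z)\in\mathbb{R}^{2p}$ with $\mathbf{1}^\top z\le k$, $|\beta_j|\le Mz_j$ for all $j\in[p]$, $z_j=0$ for $j\in\mathcal{J}_0$, $z_j=1$ for $j\in\mathcal{J}_1$, and $z_j\in[0,1]$ for $j\in\mathcal{J}_f$. Let $\bar p=|\mathcal{J}_f|$ and $\bar k=k-|\mathcal{J}_1|$. Then for any $\beta\in\mathbb{R}^p$ and $\rho>0$, the algorithm ProxConj described in the context computes $\operatorname{prox}_{\rho g_{\mathcal{N}}^*}(\beta)$ exactly with computational complexity $\mathcal{O}(p+\bar p\log\bar p)$. Moreover, it can be used as a subroutine to compute $\operatorname{prox}_{\rho g_{\mathcal{N}}}(\beta)$ exactly via $$\operatorname{prox}_{\rho g_{\mathcal{N}}}(\beta)=\beta-\rho\,\operatorname{prox}_{\rho^{-1}g_{\mathcal{N}}^*}\big(\rho^{-1}\beta\big).$$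
   Context: Conventions: $\beta_j^2/z_j$ is $0$ if $\beta_j=z_j=0$ and $+\infty$ if $\beta_j\ne0$, $z_j=0$; the infimum over an empty set is $+\infty$; $h^*(\alpha)=\sup_\beta\{\beta^\top\alpha-h(\beta)\}$; $\operatorname{prox}_h(\beta)=\operatorname{argmin}_\gamma\frac12\|\gamma-\beta\|_2^2+h(\gamma)$. Huber function on $\mathbb{R}$: $H_M(a)=\frac12a^2$ if $|a|\le M$, and $H_M(a)=M|a|-\frac12M^2$ if $|a|>M$. Algorithm ProxConj (input $\beta\in\mathbb{R}^p$, $\rho>0$, $k$, $M$): 1. Set $\bar k\leftarrow k-|\mathcal{J}_1|$, $\bar p\leftarrow|\mathcal{J}_f|$, $\bar\beta\leftarrow\beta_{\mathcal{J}_f}$; for $j\in[\bar p]$ set $\rho_j\leftarrow\rho$ if $j\le\bar k$ and $\rho_j\leftarrow0$ otherwise. 2. Find a permutation $\pi$ of $[\bar p]$ with $|\bar\beta_{\pi(1)}|\ge\dots\ge|\bar\beta_{\pi(\bar p)}|$. 3. For $j=1,\dots,\bar p$ set $\hat\alpha_j\leftarrow\operatorname{prox}_{\rho_jH_M}(|\bar\beta_{\pi(j)}|)$. Set $\mathcal{W}\leftarrow\{[1,1],[2,2],\dots,[\bar p,\bar p]\}$ (a collection of index intervals, called blocks). 4. While there exist adjacent blocks $[j_1,j_2],[j_2+1,j_3]\in\mathcal{W}$ with $\hat\alpha_{j_1}<\hat\alpha_{j_3}$: remove both from $\mathcal{W}$; set $\bar\rho\leftarrow\frac{1}{j_3-j_1+1}\sum_{j=j_1}^{j_3}\rho_j$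 and $\bar\xi\leftarrow\frac{1}{j_3-j_1+1}\sum_{j=j_1}^{j_3}|\bar\beta_{\pi(j)}|$; set $\hat\alpha_j\leftarrow\operatorname{prox}_{\bar\rho H_M}(\bar\xi)$ for all $j\in\{j_1,\dots,j_3\}$; add $[j_1,j_3]$ to $\mathcal{W}$. 5. Return $\alpha\in\mathbb{R}^p$ with $\alpha_{\mathcal{J}_0}=\beta_{\mathcal{J}_0}$, $\alpha_j=\operatorname{prox}_{\rho H_M}(\beta_j)$ for $j\in\mathcal{J}_1$, and $\alpha_{\mathcal{J}_f}=\operatorname{sgn}(\bar\beta)\odot\pi^{-1}(\hat\alpha)$, where $\pi^{-1}(\hat\alpha)$ is the vector whose $\pi(j)$-th entry is $\hat\alpha_j$ and $\odot$ is the entrywise product. The violating adjacent blocks in step 4 are located by an efficient pool-adjacent-violators (up-and-down block merging) scan: blocks are stored by their sums and common value, and one sweeps through the blocks merging a block forward and backward with its neighbours as long as there is a violation. Complexity counts elementary real-number operations and comparisons. *)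

theory Defs
  imports
    "HOL-Library.Extended_Real"
    "HOL-Library.Monad_Syntax"
    "HOL-Combinatorics.Permutations"
    "Jordan_Normal_Form.Matrix"
begin

text \<open>
  Vectors in $R^p$ are elements of \<^term>\<open>carrier_vec p :: real vec set\<close>, so coordinates are indexed
  by \<open>{..<p}\<close> and $[p]$ becomes \<open>{..<p}\<close>. Extended-valued functions have values in \<^typ>\<open>ereal\<close>; the
  infimum over the empty set is then \<open>\<infinity>\<close>.
\<close>

section \<open>Conjugates and proximal operators\<close>

definition conj_fun :: "nat \<Rightarrow> (real vec \<Rightarrow> ereal) \<Rightarrow> real vec \<Rightarrow> ereal" where
  "conj_fun p h \<alpha> = (SUP \<beta>\<in>carrier_vec p. ereal (\<alpha> \<bullet> \<beta>) - h \<beta>)"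

definition is_prox :: "nat \<Rightarrow> (real vec \<Rightarrow> ereal) \<Rightarrow> real vec \<Rightarrow> real vec \<Rightarrow> bool" where
  "is_prox p h \<beta> \<gamma> \<longleftrightarrow>
     is_arg_min (\<lambda>\<gamma>. ereal (1/2 * ((\<gamma> - \<beta>) \<bullet> (\<gamma> - \<beta>))) + h \<gamma>) (\<lambda>\<gamma>. \<gamma> \<in> carrier_vec p) \<gamma>"

text \<open>Only meaningful if the minimizer exists and is unique.\<close>

definition prox :: "nat \<Rightarrow> (real vec \<Rightarrow> ereal) \<Rightarrow> real vec \<Rightarrow> real vec" where
  "prox p h \<beta> = (THE \<gamma>. is_prox p h \<beta> \<gamma>)"

definition prox_real :: "(real \<Rightarrow> real) \<Rightarrow> real \<Rightarrow> real" where
  "prox_real h b = (THE c. is_arg_min (\<lambda>c. 1/2 * (c - b)\<^sup>2 + h c) (\<lambda>_. True) c)"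

definition huber :: "real \<Rightarrow> real \<Rightarrow> real" where
  "huber M a = (if \<bar>a\<bar> \<le> M then 1/2 * a\<^sup>2 else M * \<bar>a\<bar> - 1/2 * M\<^sup>2)"


section \<open>The perspective relaxation at a node\<close>

definition sq_over :: "real \<Rightarrow> real \<Rightarrow> ereal" where
  "sq_over b z = (if z = 0 then (if b = 0 then 0 else \<infinity>) else ereal (b\<^sup>2 / z))"

definition node_dom ::
  "nat \<Rightarrow> nat \<Rightarrow> real \<Rightarrow> nat set \<Rightarrow> nat set \<Rightarrow> nat set \<Rightarrow> (real vec \<times> real vec) set" where
  "node_dom p k M J0 J1 Jf =
     {(\<beta>, z). \<beta> \<in> carrier_vec p \<and> z \<in> carrier_vec p \<and>
        (\<Sum>j<p. z $ j) \<le> real k \<and>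
        (\<forall>j<p. \<bar>\<beta> $ j\<bar> \<le> M * z $ j) \<and>
        (\<forall>j\<in>J0. z $ j = 0) \<and>
        (\<forall>j\<in>J1. z $ j = 1) \<and>
        (\<forall>j\<in>Jf. z $ j \<in> {0..1})}"

definition g_node ::
  "nat \<Rightarrow> nat \<Rightarrow> real \<Rightarrow> nat set \<Rightarrow> nat set \<Rightarrow> nat set \<Rightarrow> real vec \<Rightarrow> ereal" where
  "g_node p k M J0 J1 Jf \<beta> =
     (INF z\<in>{z. (\<beta>, z) \<in> node_dom p k M J0 J1 Jf}.
        ereal (1/2) * (\<Sum>j<p. sq_over (\<beta> $ j) (z $ j)))"


section \<open>The algorithm, with its choices left open\<close>

text \<open>
  Positions inside $\bar\beta$ and $\hat\alpha$ are also counted from 0, so the paper's condition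
  $j \le \bar k$ reads \<open>j < k - card J1\<close>. The entries of \<open>Jf\<close> are enumerated increasingly.
\<close>

definition subvec :: "real vec \<Rightarrow> nat set \<Rightarrow> real vec" where
  "subvec \<beta> J = vec (card J) (\<lambda>i. \<beta> $ (sorted_list_of_set J ! i))"

definition weight :: "nat \<Rightarrow> nat set \<Rightarrow> real \<Rightarrow> nat \<Rightarrow> real" where
  "weight k J1 \<rho> j = (if j < k - card J1 then \<rho> else 0)"

definition sorting_perm :: "nat set \<Rightarrow> real vec \<Rightarrow> (nat \<Rightarrow> nat) \<Rightarrow> bool" where
  "sorting_perm Jf \<beta> \<pi> \<longleftrightarrow> \<pi> permutes {..<card Jf} \<and>
     (\<forall>i j. i \<le> j \<longrightarrow> j < card Jf \<longrightarrow> \<bar>subvec \<beta> Jf $ \<pi> j\<bar> \<le> \<bar>subvec \<beta> Jf $ \<pi> i\<bar>)"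

definition init_state ::
  "nat \<Rightarrow> real \<Rightarrow> nat set \<Rightarrow> nat set \<Rightarrow> real vec \<Rightarrow> real \<Rightarrow> (nat \<Rightarrow> nat) \<Rightarrow>
     (nat \<times> nat) set \<times> (nat \<Rightarrow> real)" where
  "init_state k M J1 Jf \<beta> \<rho> \<pi> =
     ((\<lambda>j. (j, j)) ` {..<card Jf},
      \<lambda>j. prox_real (\<lambda>t. weight k J1 \<rho> j * huber M t) \<bar>subvec \<beta> Jf $ \<pi> j\<bar>)"

text \<open>
  One iteration of the merging loop. A state consists of the set of blocks \<open>(j1, j2)\<close>, standing for
  $[j_1,j_2]$, and of $\hat\alpha$; \<open>w\<close> and \<open>x\<close> are the sequences $\rho_j$ and
  $|\bar\beta_{\pi(j)}|$.
\<close>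

inductive merge_step ::
  "real \<Rightarrow> (nat \<Rightarrow> real) \<Rightarrow> (nat \<Rightarrow> real) \<Rightarrow>
     (nat \<times> nat) set \<times> (nat \<Rightarrow> real) \<Rightarrow> (nat \<times> nat) set \<times> (nat \<Rightarrow> real) \<Rightarrow> bool"
  for M w x where
  "\<lbrakk> (j1, j2) \<in> W; (j2 + 1, j3) \<in> W; a j1 < a j3;
     \<rho>bar = 1 / real (j3 - j1 + 1) * (\<Sum>j=j1..j3. w j);
     \<xi>bar = 1 / real (j3 - j1 + 1) * (\<Sum>j=j1..j3. x j) \<rbrakk>
   \<Longrightarrow> merge_step M w x (W, a)
        (insert (j1, j3) (W - {(j1, j2), (j2 + 1, j3)}),
         \<lambda>j. if j \<in> {j1..j3} then prox_real (\<lambda>t. \<rho>bar * huber M t) \<xi>bar else a j)"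

abbreviation loop_step ::
  "nat \<Rightarrow> real \<Rightarrow> nat set \<Rightarrow> nat set \<Rightarrow> real vec \<Rightarrow> real \<Rightarrow> (nat \<Rightarrow> nat) \<Rightarrow>
     (nat \<times> nat) set \<times> (nat \<Rightarrow> real) \<Rightarrow> (nat \<times> nat) set \<times> (nat \<Rightarrow> real) \<Rightarrow> bool" where
  "loop_step k M J1 Jf \<beta> \<rho> \<pi> \<equiv>
     merge_step M (weight k J1 \<rho>) (\<lambda>j. \<bar>subvec \<beta> Jf $ \<pi> j\<bar>)"

definition proxconj_output ::
  "nat \<Rightarrow> real \<Rightarrow> nat set \<Rightarrow> nat set \<Rightarrow> nat set \<Rightarrow> real vec \<Rightarrow> real \<Rightarrow> (nat \<Rightarrow> nat) \<Rightarrow>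
     (nat \<Rightarrow> real) \<Rightarrow> real vec \<Rightarrow> bool" where
  "proxconj_output p M J0 J1 Jf \<beta> \<rho> \<pi> a \<alpha> \<longleftrightarrow> \<alpha> \<in> carrier_vec p \<and>
     (\<forall>j\<in>J0. \<alpha> $ j = \<beta> $ j) \<and>
     (\<forall>j\<in>J1. \<alpha> $ j = prox_real (\<lambda>t. \<rho> * huber M t) (\<beta> $ j)) \<and>
     (\<forall>i<card Jf. subvec \<alpha> Jf $ \<pi> i = sgn (subvec \<beta> Jf $ \<pi> i) * a i)"

text \<open>\<open>\<alpha>\<close> is returned by some run, i.e. for some admissible permutation and order of merges.\<close>

definition proxconj_result ::
  "nat \<Rightarrow> nat \<Rightarrow> real \<Rightarrow> nat set \<Rightarrow> nat set \<Rightarrow> nat set \<Rightarrow> real vec \<Rightarrow> real \<Rightarrow> real vec \<Rightarrow> bool" where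
  "proxconj_result p k M J0 J1 Jf \<beta> \<rho> \<alpha> \<longleftrightarrow>
     (\<exists>\<pi> W a. sorting_perm Jf \<beta> \<pi> \<and>
        (loop_step k M J1 Jf \<beta> \<rho> \<pi>)\<^sup>*\<^sup>* (init_state k M J1 Jf \<beta> \<rho> \<pi>) (W, a) \<and>
        (\<nexists>s. loop_step k M J1 Jf \<beta> \<rho> \<pi> (W, a) s) \<and>
        proxconj_output p M J0 J1 Jf \<beta> \<rho> \<pi> a \<alpha>)"

definition proxconj_terminates ::
  "nat \<Rightarrow> real \<Rightarrow> nat set \<Rightarrow> nat set \<Rightarrow> real vec \<Rightarrow> real \<Rightarrow> bool" where
  "proxconj_terminates k M J1 Jf \<beta> \<rho> \<longleftrightarrow>
     (\<forall>\<pi>. sorting_perm Jf \<beta> \<pi> \<longrightarrow>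
        (\<nexists>s. s 0 = init_state k M J1 Jf \<beta> \<rho> \<pi> \<and>
             (\<forall>n. loop_step k M J1 Jf \<beta> \<rho> \<pi> (s n) (s (Suc n)))))"


section \<open>Timed implementation\<close>

text \<open>
  The timing monad: \<^term>\<open>tick x\<close> performs one elementary operation with result \<open>x\<close>. Besides the
  real-number operations and comparisons, the program below also pays one unit for every array
  access, membership test, index operation and list cell produced, so that its running time is an
  upper bound for the number of real operations and comparisons. \<open>ret\<close> is used only to hand on
  results that have already been paid for (and for constants).
\<close>

datatype 'a tm = TM (val: 'a) (time: nat)

definition bind_tm :: "'a tm \<Rightarrow> ('a \<Rightarrow> 'b tm) \<Rightarrow> 'b tm" where
  "bind_tm m f = TM (val (f (val m))) (time m + time (f (val m)))"

adhoc_overloading Monad_Syntax.bind \<rightleftharpoons> bind_tm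

definition ret :: "'a \<Rightarrow> 'a tm" where
  "ret x = TM x 0"

definition ticks :: "nat \<Rightarrow> 'a \<Rightarrow> 'a tm" where
  "ticks n x = TM x n"

abbreviation tick :: "'a \<Rightarrow> 'a tm" where
  "tick \<equiv> ticks 1"

text \<open>Closed form of the proximal operator of \<open>r * huber M\<close> at \<open>b\<close>.\<close>

definition prox_huber_tm :: "real \<Rightarrow> real \<Rightarrow> real \<Rightarrow> real tm" where
  "prox_huber_tm M r b = do {
     s \<leftarrow> tick (1 + r);
     t \<leftarrow> tick (s * M);
     c \<leftarrow> tick \<bar>b\<bar>;
     inner \<leftarrow> tick (c \<le> t);
     if inner then tick (b / s)
     else do {
       d \<leftarrow> tick (r * M);
       pos \<leftarrow> tick (0 < b);
       if pos then tick (b - d) else tick (b + d)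
     }
   }"

fun members_tm :: "nat set \<Rightarrow> nat list \<Rightarrow> nat list tm" where
  "members_tm J [] = tick []"
| "members_tm J (j # js) = do {
     is \<leftarrow> members_tm J js;
     j' \<leftarrow> tick j;
     b \<leftarrow> tick (j' \<in> J);
     if b then tick (j' # is) else ret is
   }"

fun keys_tm :: "real vec \<Rightarrow> nat list \<Rightarrow> (real \<times> nat) list tm" where
  "keys_tm \<beta> [] = tick []"
| "keys_tm \<beta> (j # js) = do {
     b \<leftarrow> tick (\<beta> $ j);
     c \<leftarrow> tick \<bar>b\<bar>;
     xs \<leftarrow> keys_tm \<beta> js;
     tick ((c, j) # xs)
   }"

fun merge_desc_tm :: "(real \<times> nat) list \<Rightarrow> (real \<times> nat) list \<Rightarrow> (real \<times> nat) list tm" where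
  "merge_desc_tm [] ys = tick ys"
| "merge_desc_tm (x # xs) [] = tick (x # xs)"
| "merge_desc_tm (x # xs) (y # ys) = do {
     ge \<leftarrow> tick (fst y \<le> fst x);
     if ge then do { zs \<leftarrow> merge_desc_tm xs (y # ys); tick (x # zs) }
     else do { zs \<leftarrow> merge_desc_tm (x # xs) ys; tick (y # zs) }
   }"

text \<open>Computing the length and splitting the list are charged to the last line.\<close>

fun msort_desc_tm :: "(real \<times> nat) list \<Rightarrow> (real \<times> nat) list tm" where
  "msort_desc_tm xs =
     (if length xs \<le> 1 then tick xs
      else do {
        ys \<leftarrow> msort_desc_tm (take (length xs div 2) xs);
        zs \<leftarrow> msort_desc_tm (drop (length xs div 2) xs);
        ws \<leftarrow> merge_desc_tm ys zs;
        ticks (3 * length xs) ws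
      })"

datatype block = Block (sum_rho: real) (sum_xi: real) (len: nat) (bval: real)

text \<open>The counter \<open>i\<close> is the position in the sorted list.\<close>

fun init_blocks_tm :: "real \<Rightarrow> real \<Rightarrow> nat \<Rightarrow> nat \<Rightarrow> (real \<times> nat) list \<Rightarrow> block list tm" where
  "init_blocks_tm M \<rho> kbar i [] = tick []"
| "init_blocks_tm M \<rho> kbar i (x # xs) = do {
     b \<leftarrow> tick (i < kbar);
     r \<leftarrow> ret (if b then \<rho> else 0);
     v \<leftarrow> prox_huber_tm M r (fst x);
     i' \<leftarrow> tick (Suc i);
     Bs \<leftarrow> init_blocks_tm M \<rho> kbar i' xs;
     tick (Block r (fst x) 1 v # Bs)
   }"

definition merge_blocks_tm :: "real \<Rightarrow> block \<Rightarrow> block \<Rightarrow> block tm" where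
  "merge_blocks_tm M B C = do {
     sr \<leftarrow> tick (sum_rho B + sum_rho C);
     sx \<leftarrow> tick (sum_xi B + sum_xi C);
     n \<leftarrow> tick (len B + len C);
     r \<leftarrow> tick (sr / real n);
     x \<leftarrow> tick (sx / real n);
     v \<leftarrow> prox_huber_tm M r x;
     tick (Block sr sx n v)
   }"

text \<open>
  The up-and-down scan. \<open>Ls\<close> are the blocks before the current block \<open>C\<close>, nearest first, and \<open>Rs\<close>
  those after it. The current block absorbs its successor, or else its predecessor, as long as there
  is a violation, and then the scan moves on.
\<close>

fun scan_tm :: "real \<Rightarrow> block list \<Rightarrow> block \<Rightarrow> block list \<Rightarrow> block list tm" where
  "scan_tm M [] C [] = tick [C]"
| "scan_tm M [] C (R # Rs) = do {
     fwd \<leftarrow> tick (bval C < bval R);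
     if fwd then do { C' \<leftarrow> merge_blocks_tm M C R; scan_tm M [] C' Rs }
     else do { Ls' \<leftarrow> tick [C]; scan_tm M Ls' R Rs }
   }"
| "scan_tm M (L # Ls) C [] = do {
     bwd \<leftarrow> tick (bval L < bval C);
     if bwd then do { C' \<leftarrow> merge_blocks_tm M L C; scan_tm M Ls C' [] }
     else ticks (length (C # L # Ls)) (rev (C # L # Ls))
   }"
| "scan_tm M (L # Ls) C (R # Rs) = do {
     fwd \<leftarrow> tick (bval C < bval R);
     if fwd then do { C' \<leftarrow> merge_blocks_tm M C R; scan_tm M (L # Ls) C' Rs }
     else do {
       bwd \<leftarrow> tick (bval L < bval C);
       if bwd then do { C' \<leftarrow> merge_blocks_tm M L C; scan_tm M Ls C' (R # Rs) }
       else do { u \<leftarrow> tick (); scan_tm M (C # L # Ls) R Rs }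
     }
   }"

fun pava_tm :: "real \<Rightarrow> block list \<Rightarrow> block list tm" where
  "pava_tm M [] = tick []"
| "pava_tm M (B # Bs) = scan_tm M [] B Bs"

fun expand_tm :: "block list \<Rightarrow> real list tm" where
  "expand_tm [] = tick []"
| "expand_tm (B # Bs) = do {
     vs \<leftarrow> expand_tm Bs;
     ticks (len B) (replicate (len B) (bval B) @ vs)
   }"

definition vec_upd :: "real vec \<Rightarrow> nat \<Rightarrow> real \<Rightarrow> real vec" where
  "vec_upd v i x = vec (dim_vec v) (\<lambda>j. if j = i then x else v $ j)"

fun write_fixed_tm :: "real \<Rightarrow> real \<Rightarrow> real vec \<Rightarrow> nat list \<Rightarrow> real vec \<Rightarrow> real vec tm" where
  "write_fixed_tm M \<rho> \<beta> [] \<alpha> = tick \<alpha>"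
| "write_fixed_tm M \<rho> \<beta> (j # js) \<alpha> = do {
     b \<leftarrow> tick (\<beta> $ j);
     v \<leftarrow> prox_huber_tm M \<rho> b;
     \<alpha>' \<leftarrow> tick (vec_upd \<alpha> j v);
     write_fixed_tm M \<rho> \<beta> js \<alpha>'
   }"

text \<open>Applies $\pi^{-1}$: the key list carries the index at which each value has to be stored. The sign
  costs two comparisons.\<close>

fun write_free_tm :: "real vec \<Rightarrow> (real \<times> nat) list \<Rightarrow> real list \<Rightarrow> real vec \<Rightarrow> real vec tm" where
  "write_free_tm \<beta> (x # xs) (v # vs) \<alpha> = do {
     b \<leftarrow> tick (\<beta> $ snd x);
     s \<leftarrow> ticks 2 (sgn b);
     a \<leftarrow> tick (s * v);
     \<alpha>' \<leftarrow> tick (vec_upd \<alpha> (snd x) a);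
     write_free_tm \<beta> xs vs \<alpha>'
   }"
| "write_free_tm \<beta> _ _ \<alpha> = tick \<alpha>"

text \<open>The entries at \<open>J0\<close> are taken care of by starting from a copy of \<open>\<beta>\<close>.\<close>

definition proxconj_tm ::
  "nat \<Rightarrow> nat \<Rightarrow> real \<Rightarrow> nat set \<Rightarrow> nat set \<Rightarrow> real vec \<Rightarrow> real \<Rightarrow> real vec tm" where
  "proxconj_tm p k M J1 Jf \<beta> \<rho> = do {
     js1 \<leftarrow> members_tm J1 [0..<p];
     jsf \<leftarrow> members_tm Jf [0..<p];
     kbar \<leftarrow> ticks (length js1 + 1) (k - length js1);
     ks \<leftarrow> keys_tm \<beta> jsf;
     xs \<leftarrow> msort_desc_tm ks;
     Bs \<leftarrow> init_blocks_tm M \<rho> kbar 0 xs;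
     Bs' \<leftarrow> pava_tm M Bs;
     vs \<leftarrow> expand_tm Bs';
     \<alpha>0 \<leftarrow> ticks p \<beta>;
     \<alpha>1 \<leftarrow> write_fixed_tm M \<rho> \<beta> js1 \<alpha>0;
     write_free_tm \<beta> xs vs \<alpha>1
   }"

end

theory Submission
  imports Defs
begin

text \<open>
  Write \<open>H\<close> for the Huber function and \<open>H' = clip M\<close>. For fixed \<open>z\<close>, maximizing out \<open>\<beta>\<close> shows that the
  conjugate of \<open>g_node\<close> at \<open>\<alpha>\<close> is the maximum of \<open>\<Sum>j. z j * H (\<alpha> j)\<close> over the feasible \<open>z\<close>. Hence \<open>\<alpha>\<close> is
  the proximal point of the scaled conjugate at \<open>\<beta>\<close> as soon as a maximizing \<open>z\<close> satisfies
  \<open>\<beta> j - \<alpha> j = \<rho> * z j * H' (\<alpha> j)\<close>, and then \<open>z j * H' (\<alpha> j)\<close> is a subgradient of the conjugate; this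
  yields the proximal point of \<open>g_node\<close> as well.

  Such a \<open>z\<close> is read off from any final state of the merging loop. Merging two violating blocks produces a
  value between the two old ones; hence, in every block, a prefix taken on its own would get at most the
  value of the block, and a suffix at least that value. On a block with value \<open>v\<close> the numbers \<open>z j = (x j - v) / (\<rho> * H' v)\<close> decrease
  in \<open>j\<close>, and the two extreme one-element conditions put them into \<open>[0, 1]\<close>; their sum over the block is
  that of the weights \<open>\<rho> j / \<rho>\<close>, which makes \<open>z\<close> feasible and optimal because the values are sorted.
\<close>

section \<open>The Huber function and proximal points\<close>

definition clip :: "real \<Rightarrow> real \<Rightarrow> real" where
  "clip M c = max (- M) (min c M)"

text \<open>Equality case of \<open>huber_ge_affine\<close>: the Huber function is the conjugate of
  \<open>u\<^sup>2 / 2\<close> restricted to \<open>[-M, M]\<close>, and the supremum is attained at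
  the projection \<open>clip M a\<close>.\<close>

lemma huber_clip: "M > 0 \<Longrightarrow> huber M a = a * clip M a - 1/2 * (clip M a)\<^sup>2"
  unfolding huber_def clip_def by (auto simp: power2_eq_square abs_if max_def min_def)

lemma abs_clip_le: "M > 0 \<Longrightarrow> \<bar>clip M a\<bar> \<le> M"
  unfolding clip_def by auto

lemma clip_mono: "a \<le> b \<Longrightarrow> clip M a \<le> clip M b"
  unfolding clip_def by auto

lemma clip_nonneg: "M > 0 \<Longrightarrow> a \<ge> 0 \<Longrightarrow> clip M a \<ge> 0"
  unfolding clip_def by auto

lemma clip_eq_0_iff: "M > 0 \<Longrightarrow> clip M a = 0 \<longleftrightarrow> a = 0"
  unfolding clip_def by auto

lemma clip_minus: "M > 0 \<Longrightarrow> clip M (- a) = - clip M a"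
  unfolding clip_def by auto

lemma huber_minus: "huber M (- a) = huber M a"
  unfolding huber_def by simp

lemma huber_nonneg: "M > 0 \<Longrightarrow> huber M a \<ge> 0"
proof -
  assume "M > 0"
  moreover have "M * \<bar>a\<bar> - 1/2 * M\<^sup>2 \<ge> 0" if "\<bar>a\<bar> > M"
  proof -
    have "M * \<bar>a\<bar> \<ge> M * M" using that \<open>M > 0\<close> by simp
    then show ?thesis using zero_le_square[of M] unfolding power2_eq_square by linarith
  qed
  ultimately show ?thesis unfolding huber_def by auto
qed

text \<open>Fenchel-Young inequality for this conjugate pair. Replacing \<open>(a, u)\<close> by
  \<open>(-a, -u)\<close> reduces it to \<open>a \<ge> 0\<close>. There the gap is half a square if
  \<open>a \<le> M\<close>, and a product of two nonnegative factors otherwise.\<close>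

lemma huber_ge_affine:
  assumes "M > 0" "\<bar>u\<bar> \<le> M"
  shows "a * u - 1/2 * u\<^sup>2 \<le> huber M a"
proof -
  have main: "a * u - 1/2 * u\<^sup>2 \<le> huber M a" if "a \<ge> 0" "\<bar>u\<bar> \<le> M" for a u
  proof (cases "a \<le> M")
    case True
    have "0 \<le> (a - u)\<^sup>2" by simp
    then show ?thesis using True that by (simp add: huber_def power2_eq_square algebra_simps)
  next
    case False
    have "0 \<le> (M - u) * (a - (M + u) / 2)"
      using that False by (intro mult_nonneg_nonneg) auto
    moreover have "(M - u) * (a - (M + u) / 2) = M * a - 1/2 * M\<^sup>2 - (a * u - 1/2 * u\<^sup>2)"
      by (simp add: power2_eq_square field_simps)
    moreover have "huber M a = M * a - 1/2 * M\<^sup>2" using False that assms(1) by (simp add: huber_def)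
    ultimately show ?thesis by linarith
  qed
  show ?thesis
  proof (cases "a \<ge> 0")
    case True then show ?thesis using main assms by blast
  next
    case False
    then show ?thesis using main[of "- a" "- u"] assms by (simp add: huber_minus)
  qed
qed

text \<open>One slope, \<open>u = clip M a\<close>, gives equality in Fenchel-Young at
  \<open>a\<close> and a lower bound at every \<open>b\<close>.\<close>

lemma huber_subgradient: "M > 0 \<Longrightarrow> huber M a + clip M a * (b - a) \<le> huber M b"
  using huber_ge_affine[of M "clip M a" b] abs_clip_le[of M a]
  by (simp add: huber_clip[of M a] algebra_simps)

lemma huber_mono:
  assumes "M > 0" "0 \<le> a" "a \<le> b"
  shows "huber M a \<le> huber M b"
proof -
  have "0 \<le> clip M a * (b - a)" using assms clip_nonneg by simp
  then show ?thesis using huber_subgradient[OF assms(1), of a b] by linarith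
qed

text \<open>The last assumption is the optimality condition of the scalar problem. Convexity of the
  penalty leaves the square \<open>1/2 * (d - c)\<^sup>2\<close> as slack, so \<open>c\<close> is
  the only minimizer and the description in \<open>prox_real\<close> denotes it.\<close>

lemma prox_real_huber_eqI:
  assumes "M > 0" "r \<ge> 0" "c + r * clip M c = b"
  shows "prox_real (\<lambda>t. r * huber M t) b = c"
proof -
  let ?f = "\<lambda>c. 1/2 * (c - b)\<^sup>2 + r * huber M c"
  have ge: "?f c + 1/2 * (d - c)\<^sup>2 \<le> ?f d" for d
  proof -
    have "r * (huber M c + clip M c * (d - c)) \<le> r * huber M d"
      using huber_subgradient[OF assms(1)] assms(2) by (intro mult_left_mono)
    then show ?thesis unfolding assms(3)[symmetric]
      by (simp add: power2_eq_square algebra_simps)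
  qed
  have "is_arg_min ?f (\<lambda>_. True) d \<longleftrightarrow> d = c" for d
  proof
    assume "is_arg_min ?f (\<lambda>_. True) d"
    then have "?f d \<le> ?f c" by (auto simp: is_arg_min_def not_less)
    then have "(d - c)\<^sup>2 \<le> 0" using ge[of d] by linarith
    then show "d = c" by simp
  next
    assume "d = c"
    have "?f c \<le> ?f e" for e using ge[of e] zero_le_power2[of "e - c"] by linarith
    then show "is_arg_min ?f (\<lambda>_. True) d" using \<open>d = c\<close>
      by (auto simp: is_arg_min_def not_less)
  qed
  then show ?thesis unfolding prox_real_def by (intro the_equality) blast+
qed

section \<open>Closed form of the scalar proximal map\<close>

lemma val_time_bind_tm [simp]:
  "val (bind_tm m f) = val (f (val m))"
  "time (bind_tm m f) = time m + time (f (val m))"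
  by (simp_all add: bind_tm_def)

lemma val_time_ret_ticks [simp]:
  "val (ret x) = x" "time (ret x) = 0" "val (ticks n x) = x" "time (ticks n x) = n"
  by (simp_all add: ret_def ticks_def)

lemma val_prox_huber_tm:
  "val (prox_huber_tm M r b) =
     (if \<bar>b\<bar> \<le> (1 + r) * M then b / (1 + r) else if 0 < b then b - r * M else b + r * M)"
  by (simp add: prox_huber_tm_def)

lemma time_prox_huber_tm: "time (prox_huber_tm M r b) \<le> 7"
  by (simp add: prox_huber_tm_def)

text \<open>The three branches belong to the pieces on which \<open>clip M\<close> is the identity,
  \<open>M\<close> and \<open>- M\<close>; each branch condition on \<open>b\<close> puts
  \<open>c\<close> into the matching piece.\<close>

lemma prox_huber_tm_stationary:
  assumes "M > 0" "r \<ge> 0" "c = val (prox_huber_tm M r b)"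
  shows "c + r * clip M c = b"
proof -
  consider "\<bar>b\<bar> \<le> (1 + r) * M" | "b > (1 + r) * M" | "b < - ((1 + r) * M)" by linarith
  then show ?thesis
  proof cases
    case 1
    then have c: "c = b / (1 + r)" using assms by (simp add: val_prox_huber_tm)
    then have "\<bar>c\<bar> \<le> M" using 1 assms(2) by (simp add: pos_divide_le_eq mult.commute)
    then have "clip M c = c" by (auto simp: clip_def)
    then have "c + r * clip M c = c * (1 + r)" by (simp add: algebra_simps)
    then show ?thesis using c assms(2) by simp
  next
    case 2
    have "0 < (1 + r) * M" using assms by simp
    then have "\<not> \<bar>b\<bar> \<le> (1 + r) * M" "0 < b" using 2 by linarith+
    then have c: "c = b - r * M" unfolding assms(3) val_prox_huber_tm by (simp only: if_True if_False)
    then have "c > M" using 2 by (simp add: algebra_simps)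
    then have "clip M c = M" using assms by (auto simp: clip_def)
    then show ?thesis using c by simp
  next
    case 3
    have "0 < (1 + r) * M" using assms by simp
    then have "\<not> \<bar>b\<bar> \<le> (1 + r) * M" "\<not> 0 < b" using 3 by linarith+
    then have c: "c = b + r * M" unfolding assms(3) val_prox_huber_tm by (simp only: if_True if_False)
    then have "c < - M" using 3 by (simp add: algebra_simps)
    then have "clip M c = - M" using assms by (auto simp: clip_def)
    then show ?thesis using c by simp
  qed
qed

lemma prox_huber_tm_correct:
  assumes "M > 0" "r \<ge> 0"
  shows "val (prox_huber_tm M r b) = prox_real (\<lambda>t. r * huber M t) b"
  using prox_real_huber_eqI[OF assms] prox_huber_tm_stationary[OF assms] by metis

text \<open>Converse of \<open>prox_real_huber_eqI\<close>. The closed form supplies a stationary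
  point, and uniqueness identifies it with the proximal value.\<close>

lemma prox_real_huber_stationary:
  assumes "M > 0" "r \<ge> 0" "c = prox_real (\<lambda>t. r * huber M t) b"
  shows "c + r * clip M c = b"
  using assms prox_huber_tm_correct prox_huber_tm_stationary by metis

section \<open>Proximal points from subgradients\<close>

lemma scalar_prod_lessThan: "w \<in> carrier_vec p \<Longrightarrow> v \<bullet> w = (\<Sum>j<p. v $ j * w $ j)"
  by (simp add: scalar_prod_def atLeast0LessThan)

text \<open>The assumption \<open>sub\<close> makes \<open>\<beta> - \<gamma>\<close> a subgradient
  of \<open>h\<close> at \<open>\<gamma>\<close>. It cancels the linear term of the square expanded
  around \<open>\<gamma>\<close>; the slack that remains is half the squared distance to
  \<open>\<gamma>\<close>, which yields minimality and uniqueness together.\<close>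

lemma is_prox_iff_subgradient:
  assumes \<beta>: "\<beta> \<in> carrier_vec p" and \<gamma>: "\<gamma> \<in> carrier_vec p" and c: "h \<gamma> = ereal c"
    and sub: "\<And>\<delta>. \<delta> \<in> carrier_vec p \<Longrightarrow>
      ereal (c + (\<Sum>j<p. (\<beta> $ j - \<gamma> $ j) * (\<delta> $ j - \<gamma> $ j))) \<le> h \<delta>"
  shows "is_prox p h \<beta> \<delta> \<longleftrightarrow> \<delta> = \<gamma>"
proof -
  let ?q = "\<lambda>\<delta>. \<Sum>j<p. 1/2 * (\<delta> $ j - \<beta> $ j)\<^sup>2"
  let ?d = "\<lambda>\<delta>. \<Sum>j<p. 1/2 * (\<delta> $ j - \<gamma> $ j)\<^sup>2"
  let ?f = "\<lambda>\<delta>. ereal (1/2 * ((\<delta> - \<beta>) \<bullet> (\<delta> - \<beta>))) + h \<delta>"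
  have q: "1/2 * ((\<delta> - \<beta>) \<bullet> (\<delta> - \<beta>)) = ?q \<delta>" if "\<delta> \<in> carrier_vec p" for \<delta>
  proof -
    have "\<delta> - \<beta> \<in> carrier_vec p" using that \<beta> by simp
    then show ?thesis using that \<beta>
      by (simp add: scalar_prod_lessThan[of _ p] sum_distrib_left power2_eq_square)
  qed
  have ge: "ereal (?q \<gamma> + c + ?d \<delta>) \<le> ?f \<delta>" if "\<delta> \<in> carrier_vec p" for \<delta>
  proof -
    have "?q \<gamma> + ?d \<delta> = ?q \<delta> + (\<Sum>j<p. (\<beta> $ j - \<gamma> $ j) * (\<delta> $ j - \<gamma> $ j))"
      unfolding sum.distrib[symmetric] by (intro sum.cong) (auto simp: power2_eq_square algebra_simps)
    then have "ereal (?q \<gamma> + c + ?d \<delta>) =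
        ereal (?q \<delta>) + ereal (c + (\<Sum>j<p. (\<beta> $ j - \<gamma> $ j) * (\<delta> $ j - \<gamma> $ j)))"
      by simp
    also have "\<dots> \<le> ?f \<delta>" unfolding q[OF that] by (intro add_left_mono sub that)
    finally show ?thesis .
  qed
  have fg: "?f \<gamma> = ereal (?q \<gamma> + c)" using q[OF \<gamma>] c by simp
  have d0: "0 \<le> ?d \<delta>" for \<delta> by (intro sum_nonneg) simp
  show ?thesis
  proof
    assume "is_prox p h \<beta> \<delta>"
    then have \<delta>: "\<delta> \<in> carrier_vec p" and "?f \<delta> \<le> ?f \<gamma>"
      using \<gamma> by (auto simp: is_prox_def is_arg_min_def not_less)
    then have "ereal (?q \<gamma> + c + ?d \<delta>) \<le> ereal (?q \<gamma> + c)"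
      unfolding fg by (intro order_trans[OF ge[OF \<delta>]])
    then have "?d \<delta> \<le> 0" unfolding ereal_less_eq by linarith
    then have "?d \<delta> = 0" using d0[of \<delta>] by (rule antisym)
    then have "\<forall>j\<in>{..<p}. 1/2 * (\<delta> $ j - \<gamma> $ j)\<^sup>2 = 0"
      by (subst (asm) sum_nonneg_eq_0_iff) auto
    then show "\<delta> = \<gamma>" using \<delta> \<gamma> by (intro eq_vecI) auto
  next
    assume "\<delta> = \<gamma>"
    moreover have "?f \<gamma> \<le> ?f \<epsilon>" if "\<epsilon> \<in> carrier_vec p" for \<epsilon>
    proof -
      have "ereal (?q \<gamma> + c) \<le> ereal (?q \<gamma> + c + ?d \<epsilon>)"
        using d0[of \<epsilon>] unfolding ereal_less_eq by linarith
      then show ?thesis unfolding fg by (rule order_trans[OF _ ge[OF that]])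
    qed
    ultimately show "is_prox p h \<beta> \<delta>" using \<gamma>
      unfolding is_prox_def is_arg_min_def by (auto simp: not_less)
  qed
qed

lemma prox_eqI: "(\<And>\<delta>. is_prox p h \<beta> \<delta> \<longleftrightarrow> \<delta> = \<gamma>) \<Longrightarrow> prox p h \<beta> = \<gamma>"
  by (simp add: prox_def)

section \<open>The conjugate of the relaxation\<close>

text \<open>The constraints of \<open>node_dom\<close> on \<open>z\<close> alone. The coupling with
  \<open>\<beta>\<close> is absorbed when \<open>\<beta>\<close> is maximized out for fixed
  \<open>z\<close>.\<close>

definition node_weights :: "nat \<Rightarrow> nat \<Rightarrow> nat set \<Rightarrow> nat set \<Rightarrow> nat set \<Rightarrow> real vec set" where
  "node_weights p k J0 J1 Jf = {z. z \<in> carrier_vec p \<and> (\<Sum>j<p. z $ j) \<le> real k \<and>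
     (\<forall>j\<in>J0. z $ j = 0) \<and> (\<forall>j\<in>J1. z $ j = 1) \<and> (\<forall>j\<in>Jf. z $ j \<in> {0..1})}"

lemma node_weights_nonneg:
  "z \<in> node_weights p k J0 J1 Jf \<Longrightarrow> J0 \<union> J1 \<union> Jf = {..<p} \<Longrightarrow> j < p \<Longrightarrow> 0 \<le> z $ j"
  unfolding node_weights_def by (force dest: equalityD2)

lemma node_dom_iff:
  "(\<beta>, z) \<in> node_dom p k M J0 J1 Jf \<longleftrightarrow> \<beta> \<in> carrier_vec p \<and>
     z \<in> node_weights p k J0 J1 Jf \<and> (\<forall>j<p. \<bar>\<beta> $ j\<bar> \<le> M * z $ j)"
  unfolding node_dom_def node_weights_def by auto

text \<open>Perspective form of Fenchel-Young: \<open>huber_ge_affine\<close> at the slope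
  \<open>b / z\<close>, multiplied by \<open>z\<close>. For \<open>z = 0\<close> the coupling forces
  \<open>b = 0\<close>, and both sides vanish.\<close>

lemma sq_over_ge:
  assumes "M > 0" "0 \<le> z" "\<bar>b\<bar> \<le> M * z"
  shows "ereal (2 * (a * b - z * huber M a)) \<le> sq_over b z"
proof (cases "z = 0")
  case True
  then show ?thesis using assms by (auto simp: sq_over_def)
next
  case False
  then have z: "z > 0" using assms by simp
  have "\<bar>b / z\<bar> \<le> M" using assms z by (simp add: field_simps)
  then have "z * (a * (b / z) - 1/2 * (b / z)\<^sup>2) \<le> z * huber M a"
    using z by (intro mult_left_mono huber_ge_affine[OF assms(1)]) auto
  moreover have "z * (a * (b / z) - 1/2 * (b / z)\<^sup>2) = a * b - 1/2 * (b\<^sup>2 / z)"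
    using z by (simp add: power2_eq_square field_simps)
  ultimately have "a * b - 1/2 * (b\<^sup>2 / z) \<le> z * huber M a" by (simp only:)
  moreover have "2 * (s - t) \<le> c" if "s - 1/2 * c \<le> t" for s t c :: real using that by simp
  ultimately have "2 * (a * b - z * huber M a) \<le> b\<^sup>2 / z" by blast
  then show ?thesis using z by (simp add: sq_over_def)
qed

text \<open>Having a product as first argument covers \<open>z = 0\<close>: the numerator is then
  zero as well, and the convention gives zero.\<close>

lemma sq_over_clip: "sq_over (z * c) z = ereal (z * c\<^sup>2)"
  by (simp add: sq_over_def power2_eq_square)

context
  fixes p k :: nat and M :: real and J0 J1 Jf :: "nat set"
  assumes M: "M > 0" and part: "J0 \<union> J1 \<union> Jf = {..<p}"
begin

text \<open>Fenchel-Young for the relaxation, by summing \<open>sq_over_ge\<close> over the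
  coordinates. \<open>S\<close> is left as an arbitrary upper bound so that the same inequality
  bounds the conjugate and also evaluates \<open>g_node\<close> in Moreau's identity.\<close>

lemma g_node_ge:
  assumes S: "\<And>z. z \<in> node_weights p k J0 J1 Jf \<Longrightarrow> (\<Sum>j<p. z $ j * huber M (\<alpha> $ j)) \<le> S"
  shows "ereal ((\<Sum>j<p. \<alpha> $ j * \<beta> $ j) - S) \<le> g_node p k M J0 J1 Jf \<beta>"
  unfolding g_node_def
proof (rule INF_greatest)
  fix z assume "z \<in> {z. (\<beta>, z) \<in> node_dom p k M J0 J1 Jf}"
  then have z: "z \<in> node_weights p k J0 J1 Jf" and b: "\<And>j. j < p \<Longrightarrow> \<bar>\<beta> $ j\<bar> \<le> M * z $ j"
    by (auto simp: node_dom_iff)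
  have "ereal ((\<Sum>j<p. \<alpha> $ j * \<beta> $ j) - S)
      \<le> ereal (\<Sum>j<p. \<alpha> $ j * \<beta> $ j - z $ j * huber M (\<alpha> $ j))"
    using S[OF z] by (simp add: sum_subtractf)
  also have "\<dots> = ereal (1/2) * (\<Sum>j<p. ereal (2 * (\<alpha> $ j * \<beta> $ j - z $ j * huber M (\<alpha> $ j))))"
    unfolding sum_ereal times_ereal.simps sum_distrib_left
    by (intro arg_cong[of _ _ ereal] sum.cong refl) (simp add: field_simps)
  also have "\<dots> \<le> ereal (1/2) * (\<Sum>j<p. sq_over (\<beta> $ j) (z $ j))"
    using node_weights_nonneg[OF z part] b M
    by (intro ereal_mult_left_mono sum_mono sq_over_ge) auto
  finally show "ereal ((\<Sum>j<p. \<alpha> $ j * \<beta> $ j) - S)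
      \<le> ereal (1/2) * (\<Sum>j<p. sq_over (\<beta> $ j) (z $ j))" .
qed

lemma conj_fun_g_node_le:
  assumes \<alpha>: "\<alpha> \<in> carrier_vec p"
    and S: "\<And>z. z \<in> node_weights p k J0 J1 Jf \<Longrightarrow> (\<Sum>j<p. z $ j * huber M (\<alpha> $ j)) \<le> S"
  shows "conj_fun p (g_node p k M J0 J1 Jf) \<alpha> \<le> ereal S"
  unfolding conj_fun_def
proof (rule SUP_least)
  fix \<beta> :: "real vec" assume "\<beta> \<in> carrier_vec p"
  then have "ereal (\<alpha> \<bullet> \<beta> - S) \<le> g_node p k M J0 J1 Jf \<beta>"
    using g_node_ge[OF S, where \<beta> = \<beta>] by (simp add: scalar_prod_lessThan)
  then show "ereal (\<alpha> \<bullet> \<beta>) - g_node p k M J0 J1 Jf \<beta> \<le> ereal S"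
    by (cases "g_node p k M J0 J1 Jf \<beta>") auto
qed

text \<open>For fixed \<open>z\<close> this vector attains the inner supremum over
  \<open>\<beta>\<close>. As clipped values are at most \<open>M\<close> in modulus,
  \<open>z\<close> is feasible for it and bounds the infimum.\<close>

lemma g_node_le_clip:
  assumes z: "z \<in> node_weights p k J0 J1 Jf"
  shows "g_node p k M J0 J1 Jf (vec p (\<lambda>j. z $ j * clip M (\<alpha> $ j)))
     \<le> ereal (\<Sum>j<p. 1/2 * (z $ j * (clip M (\<alpha> $ j))\<^sup>2))"
proof -
  let ?y = "vec p (\<lambda>j. z $ j * clip M (\<alpha> $ j))"
  have "(?y, z) \<in> node_dom p k M J0 J1 Jf"
    using z abs_clip_le[OF M] node_weights_nonneg[OF z part]
    by (auto simp: node_dom_iff abs_mult mult.commute[of M] intro!: mult_left_mono)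
  then have "g_node p k M J0 J1 Jf ?y \<le> ereal (1/2) * (\<Sum>j<p. sq_over (?y $ j) (z $ j))"
    unfolding g_node_def by (intro INF_lower) auto
  also have "(\<Sum>j<p. sq_over (?y $ j) (z $ j)) = (\<Sum>j<p. ereal (z $ j * (clip M (\<alpha> $ j))\<^sup>2))"
    by (intro sum.cong) (auto simp: sq_over_clip)
  finally show ?thesis by (simp add: sum_distrib_left)
qed

text \<open>The vector of \<open>g_node_le_clip\<close> is a candidate in the supremum defining the
  conjugate; \<open>huber_clip\<close> turns the resulting bound into the weighted Huber
  sum.\<close>

lemma conj_fun_g_node_ge:
  assumes \<alpha>: "\<alpha> \<in> carrier_vec p" and z: "z \<in> node_weights p k J0 J1 Jf"
  shows "ereal (\<Sum>j<p. z $ j * huber M (\<alpha> $ j)) \<le> conj_fun p (g_node p k M J0 J1 Jf) \<alpha>"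
proof -
  let ?y = "vec p (\<lambda>j. z $ j * clip M (\<alpha> $ j))"
  let ?S = "\<Sum>j<p. 1/2 * (z $ j * (clip M (\<alpha> $ j))\<^sup>2)"
  have "(\<Sum>j<p. z $ j * huber M (\<alpha> $ j)) = (\<Sum>j<p. \<alpha> $ j * ?y $ j) - ?S"
    unfolding sum_subtractf[symmetric] by (intro sum.cong) (auto simp: huber_clip[OF M] algebra_simps)
  then have "ereal (\<Sum>j<p. z $ j * huber M (\<alpha> $ j)) = ereal (\<alpha> \<bullet> ?y) - ereal ?S"
    by (simp add: scalar_prod_lessThan[of _ p])
  also have "\<dots> \<le> ereal (\<alpha> \<bullet> ?y) - g_node p k M J0 J1 Jf ?y"
    by (intro ereal_minus_mono g_node_le_clip[OF z]) auto
  also have "\<dots> \<le> conj_fun p (g_node p k M J0 J1 Jf) \<alpha>"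
    unfolding conj_fun_def by (intro SUP_upper) auto
  finally show ?thesis .
qed

text \<open>A saddle point of half the squared distance to \<open>\<beta>\<close> plus
  \<open>\<rho>\<close> times the \<open>z\<close>-weighted Huber sum: stationary in
  \<open>\<alpha>\<close>, maximal in \<open>z\<close>.\<close>

definition certificate :: "real \<Rightarrow> real vec \<Rightarrow> real vec \<Rightarrow> real vec \<Rightarrow> bool" where
  "certificate \<rho> \<beta> \<alpha> z \<longleftrightarrow> \<alpha> \<in> carrier_vec p \<and> z \<in> node_weights p k J0 J1 Jf \<and>
     (\<forall>j<p. \<beta> $ j - \<alpha> $ j = \<rho> * (z $ j * clip M (\<alpha> $ j))) \<and>
     (\<forall>z'\<in>node_weights p k J0 J1 Jf.
        (\<Sum>j<p. z' $ j * huber M (\<alpha> $ j)) \<le> (\<Sum>j<p. z $ j * huber M (\<alpha> $ j)))"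

lemma conj_fun_certificate:
  assumes "certificate \<rho> \<beta> \<alpha> z"
  shows "conj_fun p (g_node p k M J0 J1 Jf) \<alpha> = ereal (\<Sum>j<p. z $ j * huber M (\<alpha> $ j))"
  using assms unfolding certificate_def
  by (intro antisym conj_fun_g_node_le conj_fun_g_node_ge) auto

text \<open>With \<open>z\<close> fixed, the weighted Huber sum is a convex minorant of the
  conjugate that touches it at \<open>\<alpha>\<close>. By stationarity its gradient there, times
  \<open>\<rho>\<close>, is \<open>\<beta> - \<alpha>\<close>.\<close>

lemma is_prox_conj_iff:
  assumes \<beta>: "\<beta> \<in> carrier_vec p" and \<rho>: "\<rho> > 0" and cert: "certificate \<rho> \<beta> \<alpha> z"
  shows "is_prox p (\<lambda>\<gamma>. ereal \<rho> * conj_fun p (g_node p k M J0 J1 Jf) \<gamma>) \<beta> \<delta> \<longleftrightarrow> \<delta> = \<alpha>"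
proof (rule is_prox_iff_subgradient[OF \<beta>])
  show \<alpha>: "\<alpha> \<in> carrier_vec p" using cert by (simp add: certificate_def)
  have z: "z \<in> node_weights p k J0 J1 Jf"
    and st: "\<And>j. j < p \<Longrightarrow> \<beta> $ j - \<alpha> $ j = \<rho> * (z $ j * clip M (\<alpha> $ j))"
    using cert by (auto simp: certificate_def)
  let ?S = "\<Sum>j<p. z $ j * huber M (\<alpha> $ j)"
  show "ereal \<rho> * conj_fun p (g_node p k M J0 J1 Jf) \<alpha> = ereal (\<rho> * ?S)"
    using conj_fun_certificate[OF cert] by simp
  fix \<delta> :: "real vec" assume \<delta>: "\<delta> \<in> carrier_vec p"
  have "\<rho> * ?S + (\<Sum>j<p. (\<beta> $ j - \<alpha> $ j) * (\<delta> $ j - \<alpha> $ j)) =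
      \<rho> * (\<Sum>j<p. z $ j * (huber M (\<alpha> $ j) + clip M (\<alpha> $ j) * (\<delta> $ j - \<alpha> $ j)))"
    unfolding sum_distrib_left sum.distrib[symmetric]
    by (intro sum.cong) (auto simp: st algebra_simps)
  also have "\<dots> \<le> \<rho> * (\<Sum>j<p. z $ j * huber M (\<delta> $ j))"
    using \<rho> node_weights_nonneg[OF z part] huber_subgradient[OF M]
    by (intro mult_left_mono sum_mono) auto
  finally have "ereal (\<rho> * ?S + (\<Sum>j<p. (\<beta> $ j - \<alpha> $ j) * (\<delta> $ j - \<alpha> $ j)))
      \<le> ereal \<rho> * ereal (\<Sum>j<p. z $ j * huber M (\<delta> $ j))" by simp
  also have "\<dots> \<le> ereal \<rho> * conj_fun p (g_node p k M J0 J1 Jf) \<delta>"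
    using \<rho> by (intro ereal_mult_left_mono conj_fun_g_node_ge \<delta> z) auto
  finally show "ereal (\<rho> * ?S + (\<Sum>j<p. (\<beta> $ j - \<alpha> $ j) * (\<delta> $ j - \<alpha> $ j)))
      \<le> ereal \<rho> * conj_fun p (g_node p k M J0 J1 Jf) \<delta>" .
qed

text \<open>With the certificate of the conjugate problem, \<open>\<beta> - \<rho> \<cdot>\<^sub>v \<alpha>\<close> has entries \<open>z $ j * clip M (\<alpha> $ j)\<close>,
  at which the Fenchel-Young inequality for \<open>\<alpha>\<close> is tight; so Moreau's identity needs no
  biconjugation.\<close>

lemma is_prox_g_node_iff:
  assumes \<beta>: "\<beta> \<in> carrier_vec p" and \<rho>: "\<rho> > 0"
    and cert: "certificate (inverse \<rho>) (inverse \<rho> \<cdot>\<^sub>v \<beta>) \<alpha> z"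
  shows "is_prox p (\<lambda>\<gamma>. ereal \<rho> * g_node p k M J0 J1 Jf \<gamma>) \<beta> \<delta> \<longleftrightarrow> \<delta> = \<beta> - \<rho> \<cdot>\<^sub>v \<alpha>"
proof -
  have \<alpha>: "\<alpha> \<in> carrier_vec p" and z: "z \<in> node_weights p k J0 J1 Jf"
    and st: "\<And>j. j < p \<Longrightarrow> (inverse \<rho> \<cdot>\<^sub>v \<beta>) $ j - \<alpha> $ j = inverse \<rho> * (z $ j * clip M (\<alpha> $ j))"
    and max: "\<And>z'. z' \<in> node_weights p k J0 J1 Jf \<Longrightarrow>
        (\<Sum>j<p. z' $ j * huber M (\<alpha> $ j)) \<le> (\<Sum>j<p. z $ j * huber M (\<alpha> $ j))"
    using cert by (auto simp: certificate_def)
  let ?g = "g_node p k M J0 J1 Jf"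
  let ?y = "vec p (\<lambda>j. z $ j * clip M (\<alpha> $ j))"
  let ?S = "\<Sum>j<p. z $ j * huber M (\<alpha> $ j)"
  have y: "\<beta> - \<rho> \<cdot>\<^sub>v \<alpha> = ?y"
  proof (rule eq_vecI)
    fix j assume "j < dim_vec ?y"
    then have j: "j < p" by simp
    have "\<beta> $ j - \<rho> * \<alpha> $ j = \<rho> * (inverse \<rho> * \<beta> $ j - \<alpha> $ j)" using \<rho> by (simp add: algebra_simps)
    also have "\<dots> = z $ j * clip M (\<alpha> $ j)" using st[OF j] j \<beta> \<rho> by simp
    finally show "(\<beta> - \<rho> \<cdot>\<^sub>v \<alpha>) $ j = ?y $ j" using j \<beta> \<alpha> by simp
  qed (use \<beta> \<alpha> in simp)
  have S: "(\<Sum>j<p. \<alpha> $ j * ?y $ j) - ?S = (\<Sum>j<p. 1/2 * (z $ j * (clip M (\<alpha> $ j))\<^sup>2))"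
    unfolding sum_subtractf[symmetric] by (intro sum.cong) (auto simp: huber_clip[OF M] algebra_simps)
  \<comment> \<open>Two bounds meet: the explicit point bounds the infimum from above, Fenchel-Young
    with \<open>S\<close> the attained maximum bounds it from below.\<close>
  have gy: "?g ?y = ereal ((\<Sum>j<p. \<alpha> $ j * ?y $ j) - ?S)"
    using g_node_le_clip[OF z, of \<alpha>] g_node_ge[OF max, of ?y] unfolding S by (rule antisym)
  have "is_prox p (\<lambda>\<gamma>. ereal \<rho> * ?g \<gamma>) \<beta> \<delta> \<longleftrightarrow> \<delta> = ?y"
  proof (rule is_prox_iff_subgradient[OF \<beta>])
    show "ereal \<rho> * ?g ?y = ereal (\<rho> * ((\<Sum>j<p. \<alpha> $ j * ?y $ j) - ?S))" by (simp add: gy)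
    fix \<delta> :: "real vec" assume \<delta>: "\<delta> \<in> carrier_vec p"
    have b: "\<beta> $ j - ?y $ j = \<rho> * \<alpha> $ j" if "j < p" for j
      using that \<beta> \<alpha> unfolding y[symmetric] by simp
    \<comment> \<open>Because \<open>\<beta> - ?y\<close> equals
      \<open>\<rho> \<cdot>\<^sub>v \<alpha>\<close>, the affine function required as a minorant is
      \<open>\<rho>\<close> times the Fenchel-Young bound with slope
      \<open>\<alpha>\<close>.\<close>
    have "\<rho> * ((\<Sum>j<p. \<alpha> $ j * ?y $ j) - ?S) + (\<Sum>j<p. (\<beta> $ j - ?y $ j) * (\<delta> $ j - ?y $ j))
        = \<rho> * ((\<Sum>j<p. \<alpha> $ j * \<delta> $ j) - ?S)"
    proof -
      have "(\<Sum>j<p. (\<beta> $ j - ?y $ j) * (\<delta> $ j - ?y $ j)) = (\<Sum>j<p. \<rho> * (\<alpha> $ j * \<delta> $ j - \<alpha> $ j * ?y $ j))"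
        by (intro sum.cong refl) (simp only: b lessThan_iff algebra_simps)
      then show ?thesis
        by (simp only: sum_distrib_left[symmetric] sum_subtractf algebra_simps)
    qed
    then have "ereal (\<rho> * ((\<Sum>j<p. \<alpha> $ j * ?y $ j) - ?S)
         + (\<Sum>j<p. (\<beta> $ j - ?y $ j) * (\<delta> $ j - ?y $ j)))
        = ereal \<rho> * ereal ((\<Sum>j<p. \<alpha> $ j * \<delta> $ j) - ?S)" by simp
    also have "\<dots> \<le> ereal \<rho> * ?g \<delta>" using \<rho>
      by (intro ereal_mult_left_mono g_node_ge max) auto
    finally show "ereal (\<rho> * ((\<Sum>j<p. \<alpha> $ j * ?y $ j) - ?S)
         + (\<Sum>j<p. (\<beta> $ j - ?y $ j) * (\<delta> $ j - ?y $ j))) \<le> ereal \<rho> * ?g \<delta>" .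
  qed simp
  then show ?thesis by (simp add: y)
qed

end

section \<open>The merging loop\<close>

text \<open>Minus the derivative in \<open>v\<close> of \<open>\<Sum>j\<in>S. 1/2 * (v - x j)\<^sup>2 + w j * huber M v\<close>; the value of a block of
  the merging loop is the zero of this function.\<close>

definition excess :: "real \<Rightarrow> (nat \<Rightarrow> real) \<Rightarrow> (nat \<Rightarrow> real) \<Rightarrow> nat set \<Rightarrow> real \<Rightarrow> real" where
  "excess M w x S v = (\<Sum>j\<in>S. x j - v - w j * clip M v)"

lemma excess_antimono:
  assumes "\<And>j. j \<in> S \<Longrightarrow> w j \<ge> 0" "u \<le> v"
  shows "excess M w x S v \<le> excess M w x S u"
  unfolding excess_def
  by (intro sum_mono diff_mono mult_left_mono clip_mono assms) (use assms in auto)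

lemma excess_strict_antimono:
  assumes "\<And>j. j \<in> S \<Longrightarrow> w j \<ge> 0" "finite S" "S \<noteq> {}" "u < v"
  shows "excess M w x S v < excess M w x S u"
  unfolding excess_def
proof (rule sum_strict_mono)
  fix j assume "j \<in> S"
  then have "w j * clip M u \<le> w j * clip M v"
    using assms by (intro mult_left_mono clip_mono) auto
  then show "x j - v - w j * clip M v < x j - u - w j * clip M u" using assms(4) by linarith
qed (use assms in auto)

lemma excess_Un_disjoint:
  "finite S \<Longrightarrow> finite T \<Longrightarrow> S \<inter> T = {} \<Longrightarrow>
    excess M w x (S \<union> T) v = excess M w x S v + excess M w x T v"
  unfolding excess_def by (rule sum.union_disjoint)

lemma excess_split:
  "i \<le> m \<Longrightarrow> m \<le> j \<Longrightarrow> excess M w x {i..j} v = excess M w x {i..m} v + excess M w x {m + 1..j} v"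
  for i m j :: nat
  by (subst excess_Un_disjoint[symmetric]) (auto intro!: arg_cong2[where f="excess M w x"])

text \<open>Stationarity of the averaged problem, multiplied by the block length, is stationarity of
  the problem summed over the block.\<close>

lemma excess_mean:
  assumes M: "M > 0" and w: "\<And>j. j \<in> {i..j3} \<Longrightarrow> w j \<ge> 0" and "i \<le> j3"
    and v: "v = prox_real (\<lambda>t. (1 / real (j3 - i + 1) * (\<Sum>j=i..j3. w j)) * huber M t)
                  (1 / real (j3 - i + 1) * (\<Sum>j=i..j3. x j))"
  shows "excess M w x {i..j3} v = 0"
proof -
  define n where "n = real (j3 - i + 1)"
  then have n: "n > 0" by simp
  have "0 \<le> 1 / n * (\<Sum>j=i..j3. w j)" using w n
    by (intro mult_nonneg_nonneg sum_nonneg) auto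
  from prox_real_huber_stationary[OF M this v[folded n_def]]
  have "v + (1 / n * (\<Sum>j=i..j3. w j)) * clip M v = 1 / n * (\<Sum>j=i..j3. x j)" .
  then have "n * (v + (1 / n * (\<Sum>j=i..j3. w j)) * clip M v) = n * (1 / n * (\<Sum>j=i..j3. x j))"
    by (rule arg_cong)
  then have "n * v + (\<Sum>j=i..j3. w j) * clip M v = (\<Sum>j=i..j3. x j)"
    using n by (simp add: algebra_simps)
  moreover have "card {i..j3} = j3 - i + 1" using assms(3) by simp
  then have "real (card {i..j3}) = n" by (simp only: n_def)
  ultimately show ?thesis unfolding excess_def sum_subtractf sum_distrib_right[symmetric] by simp
qed

text \<open>For nonnegative weights \<open>excess\<close> decreases strictly in the value, so a
  nonpositive prefix excess says that the prefix alone would get at most the value of the block. As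
  the total is zero, suffixes have nonnegative excess.\<close>

definition block_inv ::
  "real \<Rightarrow> (nat \<Rightarrow> real) \<Rightarrow> (nat \<Rightarrow> real) \<Rightarrow> (nat \<Rightarrow> real) \<Rightarrow> nat \<times> nat \<Rightarrow> bool" where
  "block_inv M w x a = (\<lambda>(i, j). i \<le> j \<and> (\<forall>m\<in>{i..j}. a m = a i) \<and> excess M w x {i..j} (a i) = 0 \<and>
     (\<forall>m\<in>{i..j}. excess M w x {i..m} (a i) \<le> 0))"

definition merge_inv ::
  "nat \<Rightarrow> real \<Rightarrow> (nat \<Rightarrow> real) \<Rightarrow> (nat \<Rightarrow> real) \<Rightarrow> (nat \<times> nat) set \<times> (nat \<Rightarrow> real) \<Rightarrow> bool" where
  "merge_inv n M w x = (\<lambda>(W, a). finite W \<and> (\<forall>B\<in>W. block_inv M w x a B) \<and>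
     (\<Union>(i, j)\<in>W. {i..j}) = {..<n} \<and>
     (\<forall>B\<in>W. \<forall>C\<in>W. B \<noteq> C \<longrightarrow> {fst B..snd B} \<inter> {fst C..snd C} = {}))"

text \<open>The new value lies between \<open>a j1\<close> and \<open>a j3\<close>. A prefix inside
  the left block had nonpositive excess at \<open>a j1\<close>, and raising the value to
  \<open>v\<close> lowers it. For a longer prefix the remaining suffix of the right block had
  nonnegative excess at \<open>a j3\<close>, hence also at \<open>v\<close>, while the total is
  zero.\<close>

lemma block_inv_merge:
  assumes M: "M > 0" and w: "\<And>j. w j \<ge> 0"
    and B: "block_inv M w x a (j1, j2)" and C: "block_inv M w x a (j2 + 1, j3)"
    and less: "a j1 < a j3"
    and v: "v = prox_real (\<lambda>t. (1 / real (j3 - j1 + 1) * (\<Sum>j=j1..j3. w j)) * huber M t)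
                  (1 / real (j3 - j1 + 1) * (\<Sum>j=j1..j3. x j))"
    and a': "\<And>m. m \<in> {j1..j3} \<Longrightarrow> a' m = v"
  shows "block_inv M w x a' (j1, j3)"
proof -
  let ?E = "excess M w x"
  have le: "j1 \<le> j2" "j2 + 1 \<le> j3" and B0: "?E {j1..j2} (a j1) = 0"
    and Bp: "\<And>m. m \<in> {j1..j2} \<Longrightarrow> ?E {j1..m} (a j1) \<le> 0"
    using B C unfolding block_inv_def prod.case by blast+
  have "\<forall>m\<in>{j2 + 1..j3}. a m = a (j2 + 1)" using C unfolding block_inv_def prod.case by blast
  moreover have "j3 \<in> {j2 + 1..j3}" using le by simp
  ultimately have aC: "a (j2 + 1) = a j3" by metis
  have C0: "?E {j2 + 1..j3} (a j3) = 0"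
    and Cp: "\<And>m. m \<in> {j2 + 1..j3} \<Longrightarrow> ?E {j2 + 1..m} (a j3) \<le> 0"
    using C unfolding block_inv_def prod.case aC by blast+
  have v0: "?E {j1..j3} v = 0" using le by (intro excess_mean[OF M w _ v]) auto
  have split: "?E {j1..j3} u = ?E {j1..j2} u + ?E {j2 + 1..j3} u" for u
    using le by (intro excess_split) auto
  \<comment> \<open>If \<open>v < a j1\<close>, the total excess at \<open>a j1\<close> would be
    negative; but there the left part is zero and the right part nonnegative, since
    \<open>a j1 < a j3\<close>.\<close>
  have ge: "a j1 \<le> v"
  proof (rule ccontr)
    assume "\<not> a j1 \<le> v"
    then have "?E {j1..j3} (a j1) < ?E {j1..j3} v"
      using w le by (intro excess_strict_antimono) auto
    moreover have "?E {j2 + 1..j3} (a j3) \<le> ?E {j2 + 1..j3} (a j1)"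
      using w less by (intro excess_antimono) auto
    ultimately show False using split v0 B0 C0 by simp
  qed
  have vle: "v \<le> a j3"
  proof (rule ccontr)
    assume "\<not> v \<le> a j3"
    then have "?E {j1..j3} v < ?E {j1..j3} (a j3)"
      using w le by (intro excess_strict_antimono) auto
    moreover have "?E {j1..j2} (a j3) \<le> ?E {j1..j2} (a j1)"
      using w less by (intro excess_antimono) auto
    ultimately show False using split v0 B0 C0 by simp
  qed
  have "?E {j1..m} v \<le> 0" if m: "m \<in> {j1..j3}" for m
  proof (cases "m \<le> j2")
    case True
    have "?E {j1..m} v \<le> ?E {j1..m} (a j1)" using w ge by (intro excess_antimono) auto
    then show ?thesis using Bp[of m] True m by simp
  next
    case False
    show ?thesis
    proof (cases "m = j3")
      case True then show ?thesis using v0 by simp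
    next
      case False
      have "?E {m + 1..j3} (a j3) \<le> ?E {m + 1..j3} v" using w vle by (intro excess_antimono) auto
      moreover have "?E {j2 + 1..j3} (a j3) = ?E {j2 + 1..m} (a j3) + ?E {m + 1..j3} (a j3)"
        using \<open>\<not> m \<le> j2\<close> m by (intro excess_split) auto
      moreover have "?E {j1..j3} v = ?E {j1..m} v + ?E {m + 1..j3} v"
        using m by (intro excess_split) auto
      ultimately show ?thesis using Cp[of m] \<open>\<not> m \<le> j2\<close> m C0 v0 by simp
    qed
  qed
  then show ?thesis using a' v0 le unfolding block_inv_def by simp
qed

lemma block_inv_cong:
  assumes "\<And>m. m \<in> {fst B..snd B} \<Longrightarrow> a' m = a m" "block_inv M w x a B"
  shows "block_inv M w x a' B"
proof (cases B)
  case (Pair i j)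
  then have "i \<le> j" using assms(2) by (simp add: block_inv_def)
  then have "a' i = a i" "\<And>m. m \<in> {i..j} \<Longrightarrow> a' m = a m" using assms(1) Pair by auto
  then show ?thesis using assms(2) unfolding Pair block_inv_def prod.case by metis
qed

text \<open>Two blocks are replaced by one, so the number of blocks is a termination measure; it is
  bundled with the invariant because the blocks have to be finite and nonempty for the
  count.\<close>

lemma merge_inv_step:
  assumes M: "M > 0" and w: "\<And>j. w j \<ge> 0"
    and inv: "merge_inv n M w x s" and step: "merge_step M w x s s'"
  shows "merge_inv n M w x s' \<and> card (fst s') < card (fst s)"
  using step
proof cases
  case (1 j1 j2 W j3 a r \<xi>)
  let ?B = "(j1, j2)" and ?C = "(j2 + 1, j3)" and ?D = "(j1, j3)"
  let ?W = "insert ?D (W - {?B, ?C})"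
  let ?a = "\<lambda>j. if j \<in> {j1..j3} then prox_real (\<lambda>t. r * huber M t) \<xi> else a j"
  have fin: "finite W" and blk: "\<And>B. B \<in> W \<Longrightarrow> block_inv M w x a B"
    and cov: "(\<Union>(i, j)\<in>W. {i..j}) = {..<n}"
    and disj: "\<And>B C. B \<in> W \<Longrightarrow> C \<in> W \<Longrightarrow> B \<noteq> C \<Longrightarrow> {fst B..snd B} \<inter> {fst C..snd C} = {}"
    using inv 1 by (auto simp: merge_inv_def)
  have le: "j1 \<le> j2" "j2 + 1 \<le> j3" using blk[OF 1(3)] blk[OF 1(4)] by (auto simp: block_inv_def)
  have D: "{j1..j3} = {j1..j2} \<union> {j2 + 1..j3}" using le by auto
  have disjD: "{j1..j3} \<inter> {fst C..snd C} = {}" if "C \<in> W - {?B, ?C}" for C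
    using disj[OF 1(3), of C] disj[OF 1(4), of C] that unfolding D by auto
  have "block_inv M w x ?a ?D"
    using block_inv_merge[OF M w blk[OF 1(3)] blk[OF 1(4)] 1(5) refl] 1 by auto
  moreover have "block_inv M w x ?a C" if "C \<in> W - {?B, ?C}" for C
    using disjD[OF that] that by (intro block_inv_cong[OF _ blk]) auto
  moreover have "(\<Union>(i, j)\<in>?W. {i..j}) = (\<Union>(i, j)\<in>W. {i..j})"
  proof -
    have "W = insert ?B (insert ?C (W - {?B, ?C}))" using 1 by auto
    then have "(\<Union>(i, j)\<in>W. {i..j}) = {j1..j2} \<union> {j2 + 1..j3} \<union> (\<Union>(i, j)\<in>W - {?B, ?C}. {i..j})"
      by (metis (no_types, lifting) UN_insert Un_assoc case_prod_conv)
    then show ?thesis using D by auto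
  qed
  moreover have "{fst B..snd B} \<inter> {fst C..snd C} = {}" if "B \<in> ?W" "C \<in> ?W" "B \<noteq> C" for B C
    using that disjD[of B] disjD[of C] disj[of B C] by auto
  ultimately have "merge_inv n M w x (?W, ?a)" using fin cov by (auto simp: merge_inv_def)
  moreover have "card ?W < card W"
  proof -
    have "card (W - {?B, ?C}) = card W - card {?B, ?C}" using 1 by (intro card_Diff_subset) auto
    also have "card {?B, ?C} = 2" using le by simp
    finally have "card (W - {?B, ?C}) = card W - 2" .
    moreover have "2 \<le> card W" using card_mono[OF fin, of "{?B, ?C}"] 1 \<open>card {?B, ?C} = 2\<close> by simp
    moreover have "card ?W \<le> Suc (card (W - {?B, ?C}))" by (rule card_insert_le_m1) auto
    ultimately show ?thesis by simp
  qed
  ultimately show ?thesis using 1 by simp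
qed

lemma merge_inv_init:
  assumes M: "M > 0" and w: "\<And>j. w j \<ge> 0"
  shows "merge_inv n M w x ((\<lambda>j. (j, j)) ` {..<n}, \<lambda>j. prox_real (\<lambda>t. w j * huber M t) (x j))"
proof -
  let ?v = "\<lambda>j. prox_real (\<lambda>t. w j * huber M t) (x j)"
  have "x j - ?v j - w j * clip M (?v j) = 0" for j
    using prox_real_huber_stationary[OF M w refl, of j "x j"] by linarith
  then have "block_inv M w x ?v (j, j)" for j by (simp add: block_inv_def excess_def)
  then show ?thesis by (auto simp: merge_inv_def)
qed

lemma merge_terminates:
  assumes M: "M > 0" and w: "\<And>j. w j \<ge> 0" and inv: "merge_inv n M w x (s 0)"
  shows "\<not> (\<forall>i. merge_step M w x (s i) (s (Suc i)))"
proof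
  assume steps: "\<forall>i. merge_step M w x (s i) (s (Suc i))"
  have "merge_inv n M w x (s i) \<and> card (fst (s i)) + i \<le> card (fst (s 0))" for i
  proof (induction i)
    case (Suc i)
    then show ?case using merge_inv_step[OF M w _ steps[rule_format, of i]] by fastforce
  qed (use inv in simp)
  \<comment> \<open>One step more than there were blocks initially is impossible.\<close>
  from this[of "Suc (card (fst (s 0)))"] show False by simp
qed

lemma merge_inv_rtranclp:
  assumes M: "M > 0" and w: "\<And>j. w j \<ge> 0"
    and "(merge_step M w x)\<^sup>*\<^sup>* s s'" "merge_inv n M w x s"
  shows "merge_inv n M w x s'"
  using assms(3,4) by induction (auto dest: merge_inv_step[OF M w])

text \<open>The dual certificate on the sorted free coordinates. Inside a block, \<open>z\<close> is proportional to
  \<open>x j - v\<close>, hence decreasing; the prefix condition for one-element prefixes and for the full block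
  minus its last element then puts it into \<open>[0, 1]\<close>.\<close>

lemma merge_certificate:
  fixes k' :: nat and \<rho> :: real
  defines "w \<equiv> \<lambda>j. if j < k' then \<rho> else 0"
  assumes M: "M > 0" and \<rho>: "\<rho> > 0"
    and x: "\<And>i j. i \<le> j \<Longrightarrow> j < n \<Longrightarrow> x j \<le> x i" "\<And>j. j < n \<Longrightarrow> x j \<ge> 0"
    and inv: "merge_inv n M w x (W, a)"
    and final: "\<nexists>s. merge_step M w x (W, a) s"
  obtains z where "\<And>j. j < n \<Longrightarrow> 0 \<le> a j" "\<And>i j. i \<le> j \<Longrightarrow> j < n \<Longrightarrow> a j \<le> a i"
    "\<And>j. j < n \<Longrightarrow> z j \<in> {0..1}" "\<And>j. j < n \<Longrightarrow> x j - a j = \<rho> * (z j * clip M (a j))"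
    "\<And>f. (\<Sum>j<n. z j * f (a j)) = (\<Sum>j<min k' n. f (a j) :: real)"
proof -
  have w0: "w j \<ge> 0" for j using \<rho> by (simp add: w_def)
  have wle: "w j \<le> \<rho>" for j using \<rho> by (simp add: w_def)
  have fin: "finite W" and blk: "\<And>B. B \<in> W \<Longrightarrow> block_inv M w x a B"
    and cov: "(\<Union>(i, j)\<in>W. {i..j}) = {..<n}"
    and disj: "\<And>B C. B \<in> W \<Longrightarrow> C \<in> W \<Longrightarrow> B \<noteq> C \<Longrightarrow> {fst B..snd B} \<inter> {fst C..snd C} = {}"
    using inv by (auto simp: merge_inv_def)
  let ?E = "excess M w x"
  have block_of: "\<exists>i l. (i, l) \<in> W \<and> m \<in> {i..l}" if "m < n" for m
  proof -
    have "m \<in> (\<Union>(i, j)\<in>W. {i..j})" using that cov by simp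
    then show ?thesis by clarsimp blast
  qed
  have bl: "i \<le> l" "l < n" "\<And>m. m \<in> {i..l} \<Longrightarrow> a m = a i" "?E {i..l} (a i) = 0"
    "\<And>m. m \<in> {i..l} \<Longrightarrow> ?E {i..m} (a i) \<le> 0" if "(i, l) \<in> W" for i l
  proof -
    have "i \<le> l \<and> (\<forall>m\<in>{i..l}. a m = a i) \<and> ?E {i..l} (a i) = 0 \<and>
        (\<forall>m\<in>{i..l}. ?E {i..m} (a i) \<le> 0)"
      using blk[OF that] unfolding block_inv_def prod.case .
    then show "i \<le> l" "?E {i..l} (a i) = 0" "\<And>m. m \<in> {i..l} \<Longrightarrow> a m = a i" 
      "\<And>m. m \<in> {i..l} \<Longrightarrow> ?E {i..m} (a i) \<le> 0"
      by blast+
    from \<open>i \<le> l\<close> have "l \<in> (\<Union>(i, j)\<in>W. {i..j})" using that by (intro UN_I[of "(i, l)"]) auto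
    then show "l < n" unfolding cov by simp
  qed
  have a0: "0 \<le> a j" if j: "j < n" for j
  proof -
    obtain i l where B: "(i, l) \<in> W" "j \<in> {i..l}" using block_of[OF j] by blast
    have "0 \<le> a i"
    proof (rule ccontr)
      \<comment> \<open>The excess at 0 would be negative, although at 0 it is just the sum of the
        nonnegative \<open>x j\<close>.\<close>
      assume "\<not> 0 \<le> a i"
      then have "?E {i..l} 0 < ?E {i..l} (a i)"
        using w0 bl(1)[OF B(1)] by (intro excess_strict_antimono) auto
      moreover have "clip M 0 = 0" using clip_eq_0_iff[OF M] by simp
      then have "0 \<le> ?E {i..l} 0" unfolding excess_def using x(2) bl(2)[OF B(1)]
        by (intro sum_nonneg) auto
      ultimately show False using bl(4)[OF B(1)] by simp
    qed
    then show ?thesis using bl(3)[OF B] by simp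
  qed
  have step_le: "a (Suc j) \<le> a j" if j: "Suc j < n" for j
  proof -
    obtain i l where B: "(i, l) \<in> W" "j \<in> {i..l}" using block_of[of j] j by auto
    obtain i' l' where C: "(i', l') \<in> W" "Suc j \<in> {i'..l'}" using block_of[of "Suc j"] j by auto
    show ?thesis
    proof (cases "(i, l) = (i', l')")
      case True
      then show ?thesis using bl(3)[OF B] bl(3)[OF C] by simp
    next
      case False
      then have "{i..l} \<inter> {i'..l'} = {}" using disj[OF B(1) C(1)] by simp
      \<comment> \<open>Disjoint intervals containing \<open>j\<close> and \<open>Suc j\<close> must
        meet exactly between them, so the two blocks are adjacent and \<open>final\<close> rules out
        a violation.\<close>
      then have "l = j" "i' = j + 1" using B(2) C(2) by (auto simp: disjoint_iff)
      then have BC: "(i, j) \<in> W" "(j + 1, l') \<in> W" using B(1) C(1) by auto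
      have "\<not> a i < a l'"
        using final merge_step.intros[OF BC _ refl refl, of a] by blast
      moreover have "a l' = a i'" using C by (intro bl(3)[OF C(1)]) auto
      ultimately show ?thesis using bl(3)[OF B] bl(3)[OF C] by simp
    qed
  qed
  have a_dec: "a j \<le> a i" if "i \<le> j" "j < n" for i j
    using that by (induction j rule: dec_induct) (auto intro: order_trans step_le)
  \<comment> \<open>Where \<open>a j \<noteq> 0\<close>, stationarity determines \<open>z\<close>.
    Where \<open>a j = 0\<close>, \<open>clip\<close> vanishes and any value is stationary; the
    normalized weight is taken so that block sums agree there too.\<close>
  define z where "z j = (if a j = 0 then w j / \<rho> else (x j - a j) / (\<rho> * clip M (a j)))" for j
  have clip_pos: "0 < clip M (a j)" if "j < n" "a j \<noteq> 0" for j
    using clip_nonneg[OF M a0[OF that(1)]] clip_eq_0_iff[OF M] that(2) by (metis less_le)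
  have x0: "x j = 0" if j: "j < n" "a j = 0" for j
  proof -
    obtain i l where B: "(i, l) \<in> W" "j \<in> {i..l}" using block_of[OF j(1)] by blast
    have "a i = 0" using bl(3)[OF B] j by simp
    moreover have "clip M 0 = 0" using clip_eq_0_iff[OF M] by simp
    ultimately have "(\<Sum>j=i..l. x j) = 0" using bl(4)[OF B(1)] by (simp add: excess_def)
    then show ?thesis using B x(2) bl(2)[OF B(1)]
      by (subst (asm) sum_nonneg_eq_0_iff) auto
  qed
  have stat: "x j - a j = \<rho> * (z j * clip M (a j))" if j: "j < n" for j
  proof (cases "a j = 0")
    case True
    then show ?thesis using x0[OF j] clip_eq_0_iff[OF M] by simp
  next
    case False
    then show ?thesis using clip_pos[OF j] \<rho> by (simp add: z_def)
  qed
  have z01: "z j \<in> {0..1}" if j: "j < n" for j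
  proof (cases "a j = 0")
    case True
    then show ?thesis using w0[of j] wle[of j] \<rho> by (simp add: z_def)
  next
    case False
    obtain i l where B: "(i, l) \<in> W" "j \<in> {i..l}" using block_of[OF j] by blast
    note c = clip_pos[OF j False]
    have aj: "a j = a i" using bl(3)[OF B] by simp
    \<comment> \<open>The one-element prefix bounds \<open>x i\<close>, the largest entry of the
      block, from above.\<close>
    have "?E {i..i} (a i) \<le> 0" using bl(1)[OF B(1)] by (intro bl(5)[OF B(1)]) auto
    then have "x i - a j \<le> w i * clip M (a j)" by (simp add: excess_def aj)
    also have "\<dots> \<le> \<rho> * clip M (a j)" using wle[of i] c by (intro mult_right_mono) auto
    finally have up: "x j - a j \<le> \<rho> * clip M (a j)" using x(1)[of i j] j B(2) by simp
    \<comment> \<open>The one-element suffix bounds \<open>x l\<close>, the smallest entry, from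
      below. If \<open>i = l\<close> it is the whole block, with excess zero.\<close>
    have "0 \<le> ?E {l..l} (a i)"
    proof (cases "i = l")
      case False
      then have "?E {i..l} (a i) = ?E {i..l - 1} (a i) + ?E {l - 1 + 1..l} (a i)"
        using bl(1)[OF B(1)] by (intro excess_split) auto
      moreover have "?E {i..l - 1} (a i) \<le> 0"
        using False bl(1)[OF B(1)] by (intro bl(5)[OF B(1)]) auto
      ultimately show ?thesis using bl(4)[OF B(1)] False bl(1)[OF B(1)] by simp
    qed (use bl(4)[OF B(1)] in simp)
    then have "w l * clip M (a j) \<le> x l - a j" by (simp add: excess_def aj)
    moreover have "0 \<le> w l * clip M (a j)" using w0[of l] c by simp
    ultimately have "0 \<le> x j - a j" using x(1)[of j l] B(2) bl(2)[OF B(1)] by simp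
    then show ?thesis using up c \<rho> False by (simp add: z_def)
  qed
  \<comment> \<open>\<open>f (a j)\<close> is constant on blocks, so only block sums of
    \<open>z\<close> matter, and these equal the block sums of \<open>w j / \<rho>\<close>, the
    indicator of the first \<open>k'\<close> positions. Leaving \<open>f\<close> general gives both
    the budget (constant 1) and the objective (Huber).\<close>
  have zsum: "(\<Sum>j<n. z j * f (a j)) = (\<Sum>j<min k' n. f (a j))" for f :: "real \<Rightarrow> real"
  proof -
    have part: "(\<Sum>j<n. h j) = (\<Sum>(i, l)\<in>W. \<Sum>j=i..l. h j)" for h :: "nat \<Rightarrow> real"
    proof -
      have "{..<n} = (\<Union>B\<in>W. {fst B..snd B})"
        unfolding cov[symmetric] by (simp add: case_prod_beta)
      then have "(\<Sum>j<n. h j) = (\<Sum>j\<in>(\<Union>B\<in>W. {fst B..snd B}). h j)" by simp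
      also have "\<dots> = (\<Sum>B\<in>W. \<Sum>j\<in>{fst B..snd B}. h j)"
        using fin disj by (intro sum.UNION_disjoint) simp_all
      finally show ?thesis by (simp add: case_prod_beta)
    qed
    have blk_eq: "(\<Sum>j=i..l. z j) = (\<Sum>j=i..l. w j / \<rho>)" if B: "(i, l) \<in> W" for i l
    proof (cases "a i = 0")
      case True
      then have "z j = w j / \<rho>" if "j \<in> {i..l}" for j
        unfolding z_def bl(3)[OF B that] by simp
      then show ?thesis by (intro sum.cong) auto
    next
      case False
      have "i < n" using bl(1,2)[OF B] by simp
      note c = clip_pos[OF this False]
      have "z j = (x j - a i) / (\<rho> * clip M (a i))" if "j \<in> {i..l}" for j
        using False unfolding z_def bl(3)[OF B that] by simp
      then have "(\<Sum>j=i..l. z j) = (\<Sum>j=i..l. (x j - a i) / (\<rho> * clip M (a i)))"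
        by (intro sum.cong) auto
      also have "\<dots> = (\<Sum>j=i..l. x j - a i) / (\<rho> * clip M (a i))" by (simp add: sum_divide_distrib)
      also have "(\<Sum>j=i..l. x j - a i) = (\<Sum>j=i..l. w j) * clip M (a i)"
        using bl(4)[OF B] by (simp add: excess_def sum_subtractf sum_distrib_right)
      finally show ?thesis using c by (simp add: sum_divide_distrib)
    qed
    have "(\<Sum>j<n. z j * f (a j)) = (\<Sum>(i, l)\<in>W. \<Sum>j=i..l. w j / \<rho> * f (a j))"
      unfolding part
    proof (intro sum.cong refl, clarify)
      fix i l assume B: "(i, l) \<in> W"
      have "(\<Sum>j=i..l. h j * f (a j)) = (\<Sum>j=i..l. h j) * f (a i)" for h :: "nat \<Rightarrow> real"
        unfolding sum_distrib_right by (intro sum.cong refl) (simp only: bl(3)[OF B])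
      then show "(\<Sum>j=i..l. z j * f (a j)) = (\<Sum>j=i..l. w j / \<rho> * f (a j))"
        using blk_eq[OF B] by (simp only:)
    qed
    also have "\<dots> = (\<Sum>j<n. w j / \<rho> * f (a j))" unfolding part ..
    also have "\<dots> = (\<Sum>j\<in>{..<n} \<inter> {..<k'}. f (a j))"
      unfolding sum.inter_restrict[OF finite_lessThan] using \<rho>
      by (intro sum.cong) (auto simp: w_def)
    also have "{..<n} \<inter> {..<k'} = {..<min k' n}" by auto
    finally show ?thesis .
  qed
  from that[OF a0 a_dec z01 stat zsum] show thesis by blast
qed

text \<open>A fractional knapsack with unit sizes: for decreasing profits it is optimal to fill the
  first \<open>k'\<close> places. If \<open>n \<le> k'\<close> the bound \<open>z j \<le> 1\<close>
  suffices; otherwise \<open>h k'\<close> serves as the multiplier of the budget.\<close>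

lemma weighted_sum_le_sum_prefix:
  fixes h z :: "nat \<Rightarrow> real"
  assumes h: "\<And>i j. i \<le> j \<Longrightarrow> j < n \<Longrightarrow> h j \<le> h i" "\<And>j. j < n \<Longrightarrow> 0 \<le> h j"
    and z: "\<And>j. j < n \<Longrightarrow> z j \<in> {0..1}" "(\<Sum>j<n. z j) \<le> real k'"
  shows "(\<Sum>j<n. z j * h j) \<le> (\<Sum>j<min k' n. h j)"
proof (cases "n \<le> k'")
  case True
  have "(\<Sum>j<n. z j * h j) \<le> (\<Sum>j<n. 1 * h j)" using h z by (intro sum_mono mult_right_mono) auto
  then show ?thesis using True by (simp add: min_absorb2)
next
  case False
  define e where "e j = (if j < k' then 1 else 0 :: real)" for j
  have e: "(\<Sum>j<n. e j * g j) = (\<Sum>j<k'. g j)" for g :: "nat \<Rightarrow> real"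
  proof -
    have "(\<Sum>j<n. e j * g j) = (\<Sum>j\<in>{..<n} \<inter> {..<k'}. g j)"
      unfolding sum.inter_restrict[OF finite_lessThan] by (intro sum.cong) (auto simp: e_def)
    also have "{..<n} \<inter> {..<k'} = {..<k'}" using False by auto
    finally show ?thesis .
  qed
  \<comment> \<open>Before \<open>k'\<close> the first factor is nonpositive and the second
    nonnegative; from \<open>k'\<close> on the signs are swapped.\<close>
  have "(\<Sum>j<n. (z j - e j) * (h j - h k')) \<le> 0"
  proof (rule sum_nonpos)
    fix j assume j: "j \<in> {..<n}"
    show "(z j - e j) * (h j - h k') \<le> 0"
    proof (cases "j < k'")
      case True
      then show ?thesis using h(1)[of j k'] z(1)[of j] False j
        by (intro mult_nonpos_nonneg) (auto simp: e_def)
    next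
      case False
      then show ?thesis using h(1)[of k' j] z(1)[of j] j
        by (intro mult_nonneg_nonpos) (auto simp: e_def)
    qed
  qed
  also have "(\<Sum>j<n. (z j - e j) * (h j - h k')) =
      (\<Sum>j<n. z j * h j) - (\<Sum>j<n. e j * h j) - ((\<Sum>j<n. z j) - (\<Sum>j<n. e j * 1)) * h k'"
    by (simp add: algebra_simps sum.distrib sum_subtractf sum_distrib_left sum_distrib_right)
  finally have "(\<Sum>j<n. z j * h j) \<le> (\<Sum>j<k'. h j) + ((\<Sum>j<n. z j) - real k') * h k'"
    unfolding e by simp
  moreover have "((\<Sum>j<n. z j) - real k') * h k' \<le> 0"
    using z(2) h(2)[of k'] False by (intro mult_nonpos_nonneg) auto
  ultimately show ?thesis using False by (simp add: min_absorb1)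
qed

section \<open>The timed implementation\<close>

lemma members_tm:
  "val (members_tm J js) = filter (\<lambda>j. j \<in> J) js" "time (members_tm J js) \<le> 3 * length js + 1"
  by (induction js) auto

lemma keys_tm:
  "val (keys_tm \<beta> js) = map (\<lambda>j. (\<bar>\<beta> $ j\<bar>, j)) js" "time (keys_tm \<beta> js) = 3 * length js + 1"
  by (induction js) auto

section \<open>Merge sort\<close>

lemma mset_merge_desc_tm: "mset (val (merge_desc_tm xs ys)) = mset xs + mset ys"
  by (induction xs ys rule: merge_desc_tm.induct) auto

lemma set_merge_desc_tm: "set (val (merge_desc_tm xs ys)) = set xs \<union> set ys"
  using arg_cong[OF mset_merge_desc_tm, of set_mset] by simp

lemma sorted_merge_desc_tm:
  assumes "sorted_wrt (\<lambda>a b. fst b \<le> fst a) xs" "sorted_wrt (\<lambda>a b. fst b \<le> fst a) ys"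
  shows "sorted_wrt (\<lambda>a b. fst b \<le> fst a) (val (merge_desc_tm xs ys))"
  using assms
  by (induction xs ys rule: merge_desc_tm.induct)
    (auto simp: set_merge_desc_tm not_le intro: order_trans less_imp_le)

lemma time_merge_desc_tm: "time (merge_desc_tm xs ys) \<le> 2 * (length xs + length ys) + 1"
  by (induction xs ys rule: merge_desc_tm.induct) auto

declare msort_desc_tm.simps [simp del]

lemma mset_msort_desc_tm: "mset (val (msort_desc_tm xs)) = mset xs"
proof (induction xs rule: msort_desc_tm.induct)
  case (1 xs)
  show ?case
  proof (cases "length xs \<le> 1")
    case False
    then show ?thesis using 1
      by (subst msort_desc_tm.simps) (simp add: mset_merge_desc_tm flip: mset_append)
  qed (simp add: msort_desc_tm.simps[of xs])
qed

lemma sorted_msort_desc_tm: "sorted_wrt (\<lambda>a b. fst b \<le> fst a) (val (msort_desc_tm xs))"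
proof (induction xs rule: msort_desc_tm.induct)
  case (1 xs)
  show ?case
  proof (cases "length xs \<le> 1")
    case True
    then have "val (msort_desc_tm xs) = xs" by (simp add: msort_desc_tm.simps[of xs])
    then show ?thesis using True by (cases xs) simp_all
  next
    case False
    then show ?thesis using 1
      by (subst msort_desc_tm.simps) (simp add: sorted_merge_desc_tm)
  qed
qed

text \<open>The larger half is at most \<open>2 * n / 3\<close>, and \<open>ln (3 / 2) \<ge> 1 / 3\<close>; so one level of the recursion
  saves \<open>n / 3\<close>.\<close>

lemma entropy_halves:
  fixes n :: nat
  defines "a \<equiv> n div 2" and "b \<equiv> n - n div 2"
  assumes n: "n \<ge> 2"
  shows "18 * (real a * ln a + real b * ln b) + 6 * real n \<le> 18 * (real n * ln n)"
proof -
  \<comment> \<open>The ratio 2/3 for the larger half is attained at \<open>n = 3\<close>.\<close>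
  have ab: "a \<ge> 1" "b \<ge> 1" "a \<le> b" "a + b = n" "3 * b \<le> 2 * n"
    using n unfolding a_def b_def by linarith+
  \<comment> \<open>This is \<open>ln t \<le> t - 1\<close> at \<open>t = 2 / 3\<close>, with the
    sign reversed.\<close>
  have "ln (3 / 2 :: real) \<ge> 1 / 3"
    using ln_le_minus_one[of "2 / 3 :: real"] ln_inverse[of "3/2 :: real"] by simp
  moreover have "ln (3 / 2) \<le> ln (real n / real b)" using ab by (intro ln_mono) (auto simp: field_simps)
  ultimately have lb: "ln b \<le> ln n - 1 / 3" using ab by (simp add: ln_div)
  moreover have "ln a \<le> ln b" using ab by (intro ln_mono) auto
  ultimately have la: "ln a \<le> ln n - 1 / 3" by linarith
  have "real a * ln a + real b * ln b \<le> real a * (ln n - 1 / 3) + real b * (ln n - 1 / 3)"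
    using la lb by (intro add_mono mult_left_mono) auto
  also have "\<dots> = (real a + real b) * (ln n - 1 / 3)" by (simp only: distrib_right)
  also have "real a + real b = real n" using ab by (simp flip: of_nat_add)
  finally show ?thesis by (simp add: algebra_simps)
qed

text \<open>The factor 18 makes \<open>entropy_halves\<close> save \<open>6 * n\<close>. This pays
  for the \<open>5 * n + 1\<close> of merging and splitting and for the additive 1 of both recursive
  calls, since \<open>3 - n \<le> 1\<close> for \<open>n \<ge> 2\<close>.\<close>

lemma time_msort_desc_tm:
  "real (time (msort_desc_tm xs)) \<le> 1 + 18 * (real (length xs) * ln (real (length xs)))"
proof (induction xs rule: msort_desc_tm.induct)
  case (1 xs)
  show ?case
  proof (cases "length xs \<le> 1")
    case True
    then have "length xs = 0 \<or> length xs = 1" by linarith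
    moreover have "time (msort_desc_tm xs) = 1" using True by (simp add: msort_desc_tm.simps[of xs])
    ultimately show ?thesis by auto
  next
    case False
    let ?n = "length xs" and ?ys = "take (length xs div 2) xs" and ?zs = "drop (length xs div 2) xs"
    have len: "length (val (msort_desc_tm us)) = length us" for us
      using mset_eq_length[OF mset_msort_desc_tm] .
    have "time (msort_desc_tm xs) \<le>
        time (msort_desc_tm ?ys) + time (msort_desc_tm ?zs) + (2 * ?n + 1) + 3 * ?n"
      using False time_merge_desc_tm[of "val (msort_desc_tm ?ys)" "val (msort_desc_tm ?zs)"]
      by (subst msort_desc_tm.simps) (simp add: len)
    then have "real (time (msort_desc_tm xs)) \<le>
        real (time (msort_desc_tm ?ys)) + real (time (msort_desc_tm ?zs)) + 5 * real ?n + 1"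
      by linarith
    moreover have "length ?ys = ?n div 2" "length ?zs = ?n - ?n div 2" by auto
    note 1(1)[OF False, unfolded this(1)] 1(2)[OF False, unfolded this(2)]
    moreover have "2 \<le> ?n" using False by simp
    note entropy_halves[OF this]
    moreover have "2 \<le> real ?n" using False by simp
    ultimately show ?thesis by argo
  qed
qed

section \<open>Block lists as states of the merging loop\<close>

fun block_intervals :: "nat \<Rightarrow> block list \<Rightarrow> (nat \<times> nat) set" where
  "block_intervals s [] = {}"
| "block_intervals s (B # Bs) = insert (s, s + len B - 1) (block_intervals (s + len B) Bs)"

text \<open>The refinement relation between block lists and the values of the loop, with
  \<open>s\<close> the position of the first block. Positive lengths make the truncated subtraction
  in \<open>block_intervals\<close> harmless.\<close>

fun represents ::
  "(nat \<Rightarrow> real) \<Rightarrow> (nat \<Rightarrow> real) \<Rightarrow> (nat \<Rightarrow> real) \<Rightarrow> nat \<Rightarrow> block list \<Rightarrow> bool" where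
  "represents w x a s [] = True"
| "represents w x a s (B # Bs) \<longleftrightarrow> len B > 0 \<and> sum_rho B = sum w {s..<s + len B} \<and>
     sum_xi B = sum x {s..<s + len B} \<and> (\<forall>j\<in>{s..<s + len B}. a j = bval B) \<and>
     represents w x a (s + len B) Bs"

abbreviation total_len :: "block list \<Rightarrow> nat" where
  "total_len Bs \<equiv> sum_list (map len Bs)"

lemma block_intervals_append: "block_intervals s (As @ Bs) = block_intervals s As \<union> block_intervals (s + total_len As) Bs"
  by (induction As arbitrary: s) (auto simp: add.assoc)

lemma represents_append:
  "represents w x a s (As @ Bs) \<longleftrightarrow> represents w x a s As \<and> represents w x a (s + total_len As) Bs"
  by (induction As arbitrary: s) (auto simp: add.assoc)

lemma block_intervals_bounds:
  "represents w x a s Bs \<Longrightarrow> (i, j) \<in> block_intervals s Bs \<Longrightarrow> s \<le> i \<and> i \<le> j \<and> j < s + total_len Bs"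
  by (induction Bs arbitrary: s) fastforce+

lemma represents_cong:
  "(\<And>j. s \<le> j \<Longrightarrow> j < s + total_len Bs \<Longrightarrow> a' j = a j) \<Longrightarrow>
    represents w x a s Bs \<Longrightarrow> represents w x a' s Bs"
  by (induction Bs arbitrary: s) auto

lemma represents_value:
  "represents w x a s Bs \<Longrightarrow> s \<le> j \<Longrightarrow> j < s + total_len Bs \<Longrightarrow> \<exists>B\<in>set Bs. a j = bval B"
proof (induction Bs arbitrary: s)
  case (Cons B Bs)
  then show ?case
    by (cases "j < s + len B") (auto simp: add.assoc dest!: Cons.IH[of "s + len B"])
qed simp

lemma represents_sorted:
  assumes "represents w x a s Bs" "sorted_wrt (\<lambda>B C. bval C \<le> bval B) Bs"
    "s \<le> i" "i \<le> j" "j < s + total_len Bs"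
  shows "a j \<le> a i"
  using assms
proof (induction Bs arbitrary: s)
  case (Cons B Bs)
  show ?case
  proof (cases "s + len B \<le> i")
    case True
    then show ?thesis using Cons by (intro Cons.IH[of "s + len B"]) (auto simp: add.assoc)
  next
    case False
    then have i: "a i = bval B" using Cons.prems by auto
    show ?thesis
    proof (cases "s + len B \<le> j")
      case True
      then obtain C where "C \<in> set Bs" "a j = bval C"
        using Cons.prems represents_value[of w x a "s + len B" Bs j] by (auto simp: add.assoc)
      then show ?thesis using i Cons.prems by auto
    next
      case False
      then show ?thesis using i Cons.prems by auto
    qed
  qed
qed simp

text \<open>Sorted block values make \<open>a\<close> decreasing over all positions, so
  \<open>a j1 < a j3\<close> cannot occur for \<open>j1 \<le> j3\<close>.\<close>

lemma no_merge_step_if_sorted: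
  assumes rep: "represents w x a 0 Bs" and sorted: "sorted_wrt (\<lambda>B C. bval C \<le> bval B) Bs"
  shows "\<nexists>s. merge_step M w x (block_intervals 0 Bs, a) s"
proof
  assume "\<exists>s. merge_step M w x (block_intervals 0 Bs, a) s"
  then obtain j1 j2 j3 where *: "(j1, j2) \<in> block_intervals 0 Bs" "(j2 + 1, j3) \<in> block_intervals 0 Bs" "a j1 < a j3"
    by (auto elim: merge_step.cases)
  then have "a j3 \<le> a j1"
    using block_intervals_bounds[OF rep *(1)] block_intervals_bounds[OF rep *(2)] by (intro represents_sorted[OF rep sorted]) auto
  then show False using * by simp
qed

section \<open>Simulation of the merging loop by the scan\<close>

lemma time_merge_blocks_tm: "time (merge_blocks_tm M B C) \<le> 13"
  using time_prox_huber_tm[of M "(sum_rho B + sum_rho C) / real (len B + len C)"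
      "(sum_xi B + sum_xi C) / real (len B + len C)"]
  by (simp add: merge_blocks_tm_def)

lemma len_merge_blocks_tm: "len (val (merge_blocks_tm M B C)) = len B + len C"
  by (simp add: merge_blocks_tm_def)

text \<open>One merge in the program is one step of the loop: stored sums divided by the joint
  length are the loop's averages. The context \<open>As\<close>, \<open>Ds\<close> allows merging at
  any place of the list.\<close>

lemma merge_step_blocks:
  assumes M: "M > 0" and w: "\<And>j. w j \<ge> 0"
    and rep: "represents w x a 0 (As @ B # C # Ds)" and less: "bval B < bval C"
    and D: "D = val (merge_blocks_tm M B C)"
  shows "\<exists>a'. merge_step M w x (block_intervals 0 (As @ B # C # Ds), a) (block_intervals 0 (As @ D # Ds), a') \<and>
    represents w x a' 0 (As @ D # Ds)"
proof -
  define s where "s = total_len As"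
  define j2 where "j2 = s + len B - 1"
  define j3 where "j3 = s + len B + len C - 1"
  let ?r = "1 / real (j3 - s + 1) * (\<Sum>j=s..j3. w j)"
  let ?\<xi> = "1 / real (j3 - s + 1) * (\<Sum>j=s..j3. x j)"
  let ?v = "prox_real (\<lambda>t. ?r * huber M t) ?\<xi>"
  let ?a = "\<lambda>j. if j \<in> {s..j3} then ?v else a j"
  let ?W = "block_intervals 0 (As @ B # C # Ds)"
  have As: "represents w x a 0 As" and Ds: "represents w x a (s + len B + len C) Ds"
    and B: "len B > 0" "sum_rho B = sum w {s..<s + len B}" "sum_xi B = sum x {s..<s + len B}"
      "\<And>j. j \<in> {s..<s + len B} \<Longrightarrow> a j = bval B"
    and C: "len C > 0" "sum_rho C = sum w {s + len B..<s + len B + len C}"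
      "sum_xi C = sum x {s + len B..<s + len B + len C}"
      "\<And>j. j \<in> {s + len B..<s + len B + len C} \<Longrightarrow> a j = bval C"
    using rep by (simp_all add: represents_append s_def)
  have W: "?W = block_intervals 0 As \<union> insert (s, j2) (insert (j2 + 1, j3) (block_intervals (s + len B + len C) Ds))"
    using B(1) by (simp add: block_intervals_append s_def j2_def j3_def add.assoc)
  have len: "j3 - s + 1 = len B + len C" using B(1) by (simp add: j3_def)
  have iv: "{s..j3} = {s..<s + len B + len C}" using C(1) by (auto simp: j3_def)
  have sumBC: "(\<Sum>j=s..j3. f j) = sum f {s..<s + len B} + sum f {s + len B..<s + len B + len C}"
    for f :: "nat \<Rightarrow> real"
    unfolding iv by (rule sum.atLeastLessThan_concat[symmetric]) auto
  have r: "?r = (sum_rho B + sum_rho C) / real (len B + len C)"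
    and \<xi>: "?\<xi> = (sum_xi B + sum_xi C) / real (len B + len C)"
    unfolding sumBC len B C by simp_all
  have "0 \<le> ?r" using w by (intro mult_nonneg_nonneg sum_nonneg) auto
  then have v: "bval D = ?v"
    unfolding r \<xi> D using prox_huber_tm_correct[OF M] by (simp add: merge_blocks_tm_def)
  have "a s < a j3" using less B(1,4) C(1) C(4)[of j3] by (simp add: j3_def)
  then have step: "merge_step M w x (?W, a) (insert (s, j3) (?W - {(s, j2), (j2 + 1, j3)}), ?a)"
    unfolding W by (intro merge_step.intros) auto
  \<comment> \<open>The two removed intervals do not also come from \<open>As\<close> or
    \<open>Ds\<close>, whose intervals lie strictly to the left and right; so the set difference
    deletes nothing else.\<close>
  have merged: "insert (s, j3) (?W - {(s, j2), (j2 + 1, j3)}) = block_intervals 0 (As @ D # Ds)"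
  proof -
    have "(s, j2) \<notin> block_intervals 0 As" "(j2 + 1, j3) \<notin> block_intervals 0 As"
      using block_intervals_bounds[OF As] by (fastforce simp: s_def j2_def)+
    moreover have "(s, j2) \<notin> block_intervals (s + len B + len C) Ds" "(j2 + 1, j3) \<notin> block_intervals (s + len B + len C) Ds"
      using block_intervals_bounds[OF Ds] B(1) C(1) by (fastforce simp: j2_def)+
    ultimately show ?thesis unfolding W
      by (auto simp: block_intervals_append D len_merge_blocks_tm s_def j3_def add.assoc)
  qed
  have "represents w x ?a 0 (As @ D # Ds)"
  proof -
    have "represents w x ?a 0 As" by (rule represents_cong[OF _ As]) (auto simp: s_def)
    moreover have "represents w x ?a (s + len B + len C) Ds"
      using C(1) by (intro represents_cong[OF _ Ds]) (auto simp: j3_def)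
    moreover have "sum_rho D = sum w {s..<s + len D}" "sum_xi D = sum x {s..<s + len D}" "len D > 0"
      using B C sumBC unfolding iv by (simp_all add: D merge_blocks_tm_def add.assoc)
    moreover have "\<forall>j\<in>{s..<s + len D}. ?a j = bval D"
      unfolding v using iv by (simp add: D len_merge_blocks_tm add.assoc)
    moreover have "len D = len B + len C" by (simp add: D len_merge_blocks_tm)
    ultimately show ?thesis by (simp add: represents_append s_def add.assoc)
  qed
  with step[unfolded merged] show ?thesis by blast
qed

text \<open>Only the left stack is known to be sorted; the current block may violate on either side.
  At the right end the current block fits the stack, so the result is sorted. \<open>post\<close>
  takes \<open>M\<close> as an argument because the induction rule of the scan generalizes
  it.\<close>

lemma scan_tm_correct:
  assumes w: "\<And>j. w j \<ge> 0" and "M > 0" "represents w x a 0 (rev Ls @ C # Rs)" "sorted_wrt (\<lambda>B C. bval B \<le> bval C) Ls"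
  defines "post \<equiv> \<lambda>M Bs a Bs'. \<exists>a'. (merge_step M w x)\<^sup>*\<^sup>* (block_intervals 0 Bs, a) (block_intervals 0 Bs', a') \<and>
    represents w x a' 0 Bs' \<and> sorted_wrt (\<lambda>B C. bval C \<le> bval B) Bs' \<and> total_len Bs' = total_len Bs"
  shows "post M (rev Ls @ C # Rs) a (val (scan_tm M Ls C Rs))"
proof -
  \<comment> \<open>Prepending the simulated loop step carries \<open>post\<close> from the merged
    list back to the original one.\<close>
  have merge: "\<exists>a'. represents w x a' 0 (As @ val (merge_blocks_tm M B C) # Ds) \<and>
      (\<forall>Bs'. post M (As @ val (merge_blocks_tm M B C) # Ds) a' Bs' \<longrightarrow> post M (As @ B # C # Ds) a Bs')"
    if "M > 0" "represents w x a 0 (As @ B # C # Ds)" "bval B < bval C" for M As B C Ds a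
    using merge_step_blocks[OF that(1) w that(2,3) refl] unfolding post_def
    by (fastforce simp: len_merge_blocks_tm intro: converse_rtranclp_into_rtranclp)
  show ?thesis using assms(2-4)
  proof (induction M Ls C Rs arbitrary: a rule: scan_tm.induct)
    case (1 M C)
    then show ?case by (auto simp: post_def)
  next
    case (2 M C R Rs)
    let ?D = "val (merge_blocks_tm M C R)"
    show ?case
    proof (cases "bval C < bval R")
      case True
      with merge[of M a "[]" C R Rs] 2(3,4) obtain a' where
        a': "represents w x a' 0 (?D # Rs)" "\<And>Bs'. post M (?D # Rs) a' Bs' \<Longrightarrow> post M (C # R # Rs) a Bs'"
        unfolding rev.simps append.simps by blast
      have "post M (rev [] @ ?D # Rs) a' (val (scan_tm M [] ?D Rs))"
        by (rule 2(1)[OF True]) (simp_all del: represents.simps add: a' 2(3))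
      then show ?thesis using a'(2) True by simp
    next
      case False
      have "post M (rev [C] @ R # Rs) a (val (scan_tm M [C] R Rs))"
        by (rule 2(2)[OF False]) (use 2(3,4) in \<open>simp_all del: represents.simps\<close>)
      then show ?thesis using False by simp
    qed
  next
    case (3 M L Ls C)
    let ?D = "val (merge_blocks_tm M L C)"
    have rep: "represents w x a 0 (rev Ls @ L # C # [])" using 3(3) by simp
    show ?case
    proof (cases "bval L < bval C")
      case True
      with merge[OF 3(2) rep] obtain a' where
        a': "represents w x a' 0 (rev Ls @ [?D])"
          "\<And>Bs'. post M (rev Ls @ [?D]) a' Bs' \<Longrightarrow> post M (rev Ls @ [L, C]) a Bs'"
        by blast
      have "post M (rev Ls @ [?D]) a' (val (scan_tm M Ls ?D []))"
        by (rule 3(1)[OF True 3(2) a'(1)]) (use 3(4) in simp)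
      then show ?thesis using a'(2) True by simp
    next
      case False
      have "sorted_wrt (\<lambda>B C. bval C \<le> bval B) (rev (C # L # Ls))"
        unfolding sorted_wrt_rev using 3(4) False by fastforce
      then show ?thesis using False 3(3) unfolding post_def by auto
    qed
  next
    case (4 M L Ls C R Rs)
    let ?D = "val (merge_blocks_tm M C R)" and ?E = "val (merge_blocks_tm M L C)"
    show ?case
    proof (cases "bval C < bval R")
      case True
      with merge[OF 4(4,5)] obtain a' where
        a': "represents w x a' 0 (rev (L # Ls) @ ?D # Rs)"
          "\<And>Bs'. post M (rev (L # Ls) @ ?D # Rs) a' Bs' \<Longrightarrow> post M (rev (L # Ls) @ C # R # Rs) a Bs'"
        by blast
      have "post M (rev (L # Ls) @ ?D # Rs) a' (val (scan_tm M (L # Ls) ?D Rs))"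
        by (rule 4(1)[OF True 4(4) a'(1) 4(6)])
      then show ?thesis using a'(2) True by simp
    next
      case nf: False
      show ?thesis
      proof (cases "bval L < bval C")
        case True
        have rep: "represents w x a 0 (rev Ls @ L # C # R # Rs)" using 4(5) by simp
        from merge[OF 4(4) rep True] obtain a' where
          a': "represents w x a' 0 (rev Ls @ ?E # R # Rs)"
            "\<And>Bs'. post M (rev Ls @ ?E # R # Rs) a' Bs' \<Longrightarrow> post M (rev Ls @ L # C # R # Rs) a Bs'"
          by blast
        have "post M (rev Ls @ ?E # R # Rs) a' (val (scan_tm M Ls ?E (R # Rs)))"
          by (rule 4(2)[OF nf True 4(4) a'(1)]) (use 4(6) in simp)
        then show ?thesis using a'(2) True nf by simp
      next
        case False
        \<comment> \<open>Without a backward violation \<open>C\<close> can be pushed, and the stack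
          stays sorted.\<close>
        have "post M (rev (C # L # Ls) @ R # Rs) a (val (scan_tm M (C # L # Ls) R Rs))"
          by (rule 4(3)[OF nf False 4(4)]) (use 4(5,6) False in fastforce)+
        then show ?thesis using False nf by simp
      qed
    qed
  qed
qed

text \<open>A block on the left can only be absorbed once, at cost 15; a block on the right is absorbed at
  cost 14 or moved to the left at cost 3.\<close>

lemma time_scan_tm: "time (scan_tm M Ls C Rs) \<le> 15 * length Ls + 20 * length Rs + 5"
proof (induction M Ls C Rs rule: scan_tm.induct)
  case (2 M C R Rs)
  then show ?case
  proof (cases "bval C < bval R")
    case True
    then show ?thesis
      using time_merge_blocks_tm[of M C R] 2(1)[OF True, of "val (merge_blocks_tm M C R)"] by simp
  next
    case False
    then show ?thesis using 2(2)[OF False, of "[C]"] by simp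
  qed
next
  case (3 M L Ls C)
  show ?case
  proof (cases "bval L < bval C")
    case True
    then show ?thesis
      using time_merge_blocks_tm[of M L C] 3(1)[OF True, of "val (merge_blocks_tm M L C)"] by simp
  qed simp
next
  case (4 M L Ls C R Rs)
  show ?case
  proof (cases "bval C < bval R")
    case True
    then show ?thesis
      using time_merge_blocks_tm[of M C R] 4(1)[OF True, of "val (merge_blocks_tm M C R)"] by simp
  next
    case nf: False
    show ?thesis
    proof (cases "bval L < bval C")
      case True
      then show ?thesis using nf time_merge_blocks_tm[of M L C]
          4(2)[OF nf True, of "val (merge_blocks_tm M L C)"] by simp
    next
      case False
      then show ?thesis using nf 4(3)[OF nf False] by simp
    qed
  qed
qed simp

text \<open>\<open>s\<close> is both the program's counter and the position of the next block; the
  two agree because all initial blocks are singletons.\<close>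

lemma represents_init_blocks_tm:
  assumes "\<And>i. i < length ys \<Longrightarrow> x (s + i) = fst (ys ! i)"
    "\<And>i. i < length ys \<Longrightarrow> a (s + i) = val (prox_huber_tm M (if s + i < kbar then \<rho> else 0) (x (s + i)))"
  shows "represents (\<lambda>j. if j < kbar then \<rho> else 0) x a s (val (init_blocks_tm M \<rho> kbar s ys)) \<and>
    block_intervals s (val (init_blocks_tm M \<rho> kbar s ys)) = (\<lambda>j. (j, j)) ` {s..<s + length ys} \<and>
    total_len (val (init_blocks_tm M \<rho> kbar s ys)) = length ys \<and>
    length (val (init_blocks_tm M \<rho> kbar s ys)) = length ys"
  using assms
proof (induction ys arbitrary: s)
  case (Cons y ys)
  have IH: "represents (\<lambda>j. if j < kbar then \<rho> else 0) x a (Suc s) (val (init_blocks_tm M \<rho> kbar (Suc s) ys)) \<and>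
    block_intervals (Suc s) (val (init_blocks_tm M \<rho> kbar (Suc s) ys)) = (\<lambda>j. (j, j)) ` {Suc s..<Suc s + length ys} \<and>
    total_len (val (init_blocks_tm M \<rho> kbar (Suc s) ys)) = length ys \<and>
    length (val (init_blocks_tm M \<rho> kbar (Suc s) ys)) = length ys"
    using Cons.prems[of "Suc _"] by (intro Cons.IH) auto
  have "{s..<s + length (y # ys)} = insert s {Suc s..<Suc s + length ys}" by auto
  then show ?case using IH Cons.prems[of 0] by simp
qed simp

lemma time_init_blocks_tm: "time (init_blocks_tm M \<rho> kbar i xs) \<le> 10 * length xs + 1"
proof (induction xs arbitrary: i)
  case (Cons x xs)
  show ?case using Cons.IH[of "Suc i"] time_prox_huber_tm[of M "if i < kbar then \<rho> else 0" "fst x"]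
    by (simp split del: if_split)
qed simp

lemma time_expand_tm: "time (expand_tm Bs) = total_len Bs + 1"
  by (induction Bs) auto

lemma val_expand_tm:
  "represents w x a s Bs \<Longrightarrow> val (expand_tm Bs) = map a [s..<s + total_len Bs]"
proof (induction Bs arbitrary: s)
  case (Cons B Bs)
  have "replicate (len B) (bval B) = map a [s..<s + len B]"
    using Cons.prems by (intro nth_equalityI) auto
  moreover have "[s..<s + total_len (B # Bs)] = [s..<s + len B] @ [s + len B..<s + len B + total_len Bs]"
    using upt_add_eq_append[of s "s + len B" "total_len Bs"] by (simp add: add.assoc)
  ultimately show ?case using Cons by simp
qed simp

section \<open>Writing the output vector\<close>

lemma vec_upd_carrier: "\<alpha> \<in> carrier_vec p \<Longrightarrow> vec_upd \<alpha> i v \<in> carrier_vec p"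
  by (simp add: vec_upd_def)

lemma carrier_write_fixed_tm:
  "\<alpha> \<in> carrier_vec p \<Longrightarrow> val (write_fixed_tm M \<rho> \<beta> js \<alpha>) \<in> carrier_vec p"
  by (induction js arbitrary: \<alpha>) (auto simp: vec_upd_carrier)

lemma write_fixed_tm_nth:
  "\<alpha> \<in> carrier_vec p \<Longrightarrow> j < p \<Longrightarrow> val (write_fixed_tm M \<rho> \<beta> js \<alpha>) $ j =
      (if j \<in> set js then val (prox_huber_tm M \<rho> (\<beta> $ j)) else \<alpha> $ j)"
proof (induction js arbitrary: \<alpha>)
  case (Cons i js)
  then show ?case using Cons.IH[OF vec_upd_carrier[OF Cons.prems(1)]]
    by (auto simp: vec_upd_def)
qed simp

lemma time_write_fixed_tm: "time (write_fixed_tm M \<rho> \<beta> js \<alpha>) \<le> 9 * length js + 1"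
proof (induction js arbitrary: \<alpha>)
  case (Cons j js)
  show ?case using time_prox_huber_tm[of M \<rho> "\<beta> $ j"]
      Cons.IH[of "vec_upd \<alpha> j (val (prox_huber_tm M \<rho> (\<beta> $ j)))"] by simp
qed simp

lemma carrier_write_free_tm:
  "\<alpha> \<in> carrier_vec p \<Longrightarrow> val (write_free_tm \<beta> xs vs \<alpha>) \<in> carrier_vec p"
  by (induction \<beta> xs vs \<alpha> rule: write_free_tm.induct) (auto simp: vec_upd_def)

lemma write_free_tm_other:
  "\<alpha> \<in> carrier_vec p \<Longrightarrow> j < p \<Longrightarrow> j \<notin> snd ` set xs \<Longrightarrow> val (write_free_tm \<beta> xs vs \<alpha>) $ j = \<alpha> $ j"
  by (induction \<beta> xs vs \<alpha> rule: write_free_tm.induct) (auto simp: vec_upd_def)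

text \<open>Distinct target indices prevent later writes from overwriting earlier ones.\<close>

lemma write_free_tm_nth:
  "\<alpha> \<in> carrier_vec p \<Longrightarrow> snd ` set xs \<subseteq> {..<p} \<Longrightarrow> distinct (map snd xs) \<Longrightarrow>
    length vs = length xs \<Longrightarrow> i < length xs \<Longrightarrow>
    val (write_free_tm \<beta> xs vs \<alpha>) $ snd (xs ! i) = sgn (\<beta> $ snd (xs ! i)) * vs ! i"
proof (induction \<beta> xs vs \<alpha> arbitrary: i rule: write_free_tm.induct)
  case (1 \<beta> x xs v vs \<alpha>)
  let ?\<alpha> = "vec_upd \<alpha> (snd x) (sgn (\<beta> $ snd x) * v)"
  have u: "?\<alpha> \<in> carrier_vec p" using 1(2) by (simp add: vec_upd_def)
  show ?case
  proof (cases i)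
    case 0
    have "val (write_free_tm \<beta> xs vs ?\<alpha>) $ snd x = ?\<alpha> $ snd x"
      using 1 by (intro write_free_tm_other[OF u]) auto
    also have "\<dots> = sgn (\<beta> $ snd x) * v" using 1(2,3) by (auto simp: vec_upd_def)
    finally show ?thesis using 0 by simp
  next
    case (Suc i')
    have "val (write_free_tm \<beta> xs vs ?\<alpha>) $ snd (xs ! i') = sgn (\<beta> $ snd (xs ! i')) * vs ! i'"
      using 1(3-6) Suc by (intro 1(1)[OF u]) auto
    then show ?thesis using Suc by simp
  qed
qed auto

lemma time_write_free_tm: "time (write_free_tm \<beta> xs vs \<alpha>) \<le> 5 * length xs + 1"
  by (induction \<beta> xs vs \<alpha> rule: write_free_tm.induct) auto

section \<open>Correctness and complexity of the algorithm\<close>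

text \<open>\<open>clip\<close> is odd and the Huber function even. The second assumption is for
  \<open>sgn 0 = 0\<close>, which would otherwise erase a nonzero \<open>a\<close>.\<close>

lemma sgn_mult_clip:
  assumes "M > 0" "b = 0 \<Longrightarrow> a = 0"
  shows "clip M (sgn b * a) = sgn b * clip M a"
    "huber M (sgn b * a) = huber M a"
  using assms clip_minus[of M a] clip_eq_0_iff[of M 0] by (auto simp: sgn_real_def huber_minus)

lemma bij_betw_nth_permutes:
  assumes "finite J" "\<pi> permutes {..<card J}"
  shows "bij_betw (\<lambda>i. sorted_list_of_set J ! \<pi> i) {..<card J} J"
proof -
  have "bij_betw ((!) (sorted_list_of_set J)) {..<card J} J"
    using assms(1) by (intro bij_betw_nth) auto
  from bij_betw_trans[OF permutes_imp_bij[OF assms(2)] this] show ?thesis by (simp add: comp_def)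
qed

lemma subvec_permutes:
  "\<pi> permutes {..<card J} \<Longrightarrow> i < card J \<Longrightarrow> subvec v J $ \<pi> i = v $ (sorted_list_of_set J ! \<pi> i)"
  using permutes_in_image[of \<pi> "{..<card J}" i] by (simp add: subvec_def)

lemma weight_eq: "weight k J1 \<rho> = (\<lambda>j. if j < k - card J1 then \<rho> else 0)"
  by (auto simp: weight_def)

section \<open>Optimality of every run\<close>

context
  fixes p k :: nat and M :: real and J0 J1 Jf :: "nat set"
  assumes M: "M > 0" and part: "J0 \<union> J1 \<union> Jf = {..<p}"
    and disj: "J0 \<inter> J1 = {}" "J0 \<inter> Jf = {}" "J1 \<inter> Jf = {}" and card: "card J1 \<le> k"
begin

lemma finite_parts: "finite J0" "finite J1" "finite Jf"
proof -
  have "finite (J0 \<union> J1 \<union> Jf)" unfolding part by simp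
  then show "finite J0" "finite J1" "finite Jf" by simp_all
qed

lemma merge_inv_init_state:
  assumes "\<rho> > 0"
  shows "merge_inv (card Jf) M (weight k J1 \<rho>) (\<lambda>j. \<bar>subvec \<beta> Jf $ \<pi> j\<bar>) (init_state k M J1 Jf \<beta> \<rho> \<pi>)"
  unfolding init_state_def using assms by (intro merge_inv_init[OF M]) (simp add: weight_def)

lemma proxconj_terminates: "\<rho> > 0 \<Longrightarrow> proxconj_terminates k M J1 Jf \<beta> \<rho>"
  unfolding proxconj_terminates_def
proof safe
  fix \<pi> s assume "\<rho> > 0" and s: "s 0 = init_state k M J1 Jf \<beta> \<rho> \<pi>"
    "\<forall>n. loop_step k M J1 Jf \<beta> \<rho> \<pi> (s n) (s (Suc n))"
  then have "merge_inv (card Jf) M (weight k J1 \<rho>) (\<lambda>j. \<bar>subvec \<beta> Jf $ \<pi> j\<bar>) (s 0)"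
    using merge_inv_init_state by simp
  moreover have "\<And>j. weight k J1 \<rho> j \<ge> 0" using \<open>\<rho> > 0\<close> by (simp add: weight_def)
  ultimately show False using merge_terminates[OF M] s(2) by blast
qed

lemma sum_parts:
  assumes "bij_betw \<sigma> {..<card Jf} Jf"
  shows "(\<Sum>j<p. f j) = (\<Sum>j\<in>J0. f j) + (\<Sum>j\<in>J1. f j) + (\<Sum>i<card Jf. f (\<sigma> i) :: real)"
proof -
  have "(\<Sum>j<p. f j) = (\<Sum>j\<in>J0 \<union> J1. f j) + (\<Sum>j\<in>Jf. f j)"
    unfolding part[symmetric] using finite_parts disj by (intro sum.union_disjoint) auto
  also have "(\<Sum>j\<in>J0 \<union> J1. f j) = (\<Sum>j\<in>J0. f j) + (\<Sum>j\<in>J1. f j)"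
    using finite_parts disj by (intro sum.union_disjoint)
  also have "(\<Sum>j\<in>Jf. f j) = (\<Sum>i<card Jf. f (\<sigma> i))"
    by (rule sum.reindex_bij_betw[OF assms, symmetric])
  finally show ?thesis .
qed

lemma certificate_exists:
  assumes \<rho>: "\<rho> > 0" and res: "proxconj_result p k M J0 J1 Jf \<beta> \<rho> \<alpha>"
  obtains z where "certificate p k M J0 J1 Jf \<rho> \<beta> \<alpha> z"
proof -
  define n where "n = card Jf"
  define k' where "k' = k - card J1"
  obtain \<pi> W a where perm: "sorting_perm Jf \<beta> \<pi>"
    and run: "(loop_step k M J1 Jf \<beta> \<rho> \<pi>)\<^sup>*\<^sup>* (init_state k M J1 Jf \<beta> \<rho> \<pi>) (W, a)"
    and final: "\<nexists>s. loop_step k M J1 Jf \<beta> \<rho> \<pi> (W, a) s"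
    and out: "proxconj_output p M J0 J1 Jf \<beta> \<rho> \<pi> a \<alpha>"
    using res unfolding proxconj_result_def by blast
  define \<sigma> where "\<sigma> i = sorted_list_of_set Jf ! \<pi> i" for i
  define x where "x = (\<lambda>j. \<bar>subvec \<beta> Jf $ \<pi> j\<bar>)"
  have \<pi>: "\<pi> permutes {..<card Jf}" using perm by (simp add: sorting_perm_def)
  have \<sigma>: "bij_betw \<sigma> {..<card Jf} Jf"
    unfolding \<sigma>_def using finite_parts(3) \<pi> by (rule bij_betw_nth_permutes)
  have \<sigma>Jf: "\<sigma> i \<in> Jf" if "i < n" for i using bij_betwE[OF \<sigma>] that by (simp add: n_def)
  have sub: "subvec v Jf $ \<pi> i = v $ \<sigma> i" if "i < n" for v i
    unfolding \<sigma>_def using that \<pi> by (intro subvec_permutes) (auto simp: n_def)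
  have w0: "\<And>j. weight k J1 \<rho> j \<ge> 0" using \<rho> by (simp add: weight_def)
  have inv: "merge_inv n M (\<lambda>j. if j < k' then \<rho> else 0) x (W, a)"
    using merge_inv_rtranclp[OF M w0 run merge_inv_init_state[OF \<rho>]]
    unfolding n_def x_def weight_eq k'_def .
  have stuck: "\<nexists>s. merge_step M (\<lambda>j. if j < k' then \<rho> else 0) x (W, a) s"
    using final unfolding weight_eq k'_def x_def .
  have x_dec: "\<And>i j. i \<le> j \<Longrightarrow> j < n \<Longrightarrow> x j \<le> x i"
    using perm by (simp add: sorting_perm_def x_def n_def)
  have x0: "\<And>j. j < n \<Longrightarrow> 0 \<le> x j" by (simp add: x_def)
  obtain y where a0: "\<And>j. j < n \<Longrightarrow> 0 \<le> a j"
    and a_dec: "\<And>i j. i \<le> j \<Longrightarrow> j < n \<Longrightarrow> a j \<le> a i"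
    and y01: "\<And>j. j < n \<Longrightarrow> y j \<in> {0..1}"
    and stat: "\<And>j. j < n \<Longrightarrow> x j - a j = \<rho> * (y j * clip M (a j))"
    and ysum: "\<And>f. (\<Sum>j<n. y j * f (a j)) = (\<Sum>j<min k' n. f (a j) :: real)"
    using merge_certificate[OF M \<rho> x_dec x0 inv stuck] by blast
  define z where "z = vec p (\<lambda>j. if j \<in> J1 then 1 else if j \<in> Jf then y (inv_into {..<card Jf} \<sigma> j) else 0)"
  have Jp: "J0 \<subseteq> {..<p}" "J1 \<subseteq> {..<p}" "Jf \<subseteq> {..<p}" using part by auto
  have z\<sigma>: "z $ \<sigma> i = y i" if "i < n" for i
  proof -
    have "\<sigma> i \<in> Jf" by (rule \<sigma>Jf[OF that])
    moreover from this have "\<sigma> i < p" "\<sigma> i \<notin> J1" using Jp(3) disj(3) by blast+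
    ultimately show ?thesis using that bij_betw_inv_into_left[OF \<sigma>, of i] by (simp add: z_def n_def)
  qed
  have zJ0: "z $ j = 0" if "j \<in> J0" for j
  proof -
    have "j < p" "j \<notin> J1" "j \<notin> Jf" using that Jp(1) disj(1,2) by blast+
    then show ?thesis by (simp add: z_def)
  qed
  have zJ1: "z $ j = 1" if "j \<in> J1" for j
  proof -
    have "j < p" using that Jp(2) by blast
    then show ?thesis using that by (simp add: z_def)
  qed
  have Jf_cases: "\<exists>i<n. j = \<sigma> i" if "j \<in> Jf" for j
    using that bij_betw_imp_surj_on[OF \<sigma>] by (auto simp: n_def)
  have \<alpha>\<sigma>: "\<alpha> $ \<sigma> i = sgn (\<beta> $ \<sigma> i) * a i" if "i < n" for i
    using out that sub by (simp add: proxconj_output_def n_def)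
  have x\<sigma>: "x i = \<bar>\<beta> $ \<sigma> i\<bar>" if "i < n" for i using sub[OF that] by (simp add: x_def)
  \<comment> \<open>With \<open>x i = 0\<close>, stationarity says that \<open>- a i\<close> is
    nonnegative.\<close>
  have a_zero: "a i = 0" if i: "i < n" and "\<beta> $ \<sigma> i = 0" for i
  proof -
    have "0 \<le> \<rho> * (y i * clip M (a i))"
      using \<rho> y01[OF i] clip_nonneg[OF M a0[OF i]] by simp
    then show ?thesis using stat[OF i] x\<sigma>[OF i] that(2) a0[OF i] by simp
  qed
  note sg = sgn_mult_clip[OF M a_zero]
  have huber_\<sigma>: "huber M (\<alpha> $ \<sigma> i) = huber M (a i)" if "i < n" for i
    unfolding \<alpha>\<sigma>[OF that] using that by (intro sg(2))
  have \<alpha>: "\<alpha> \<in> carrier_vec p" using out by (simp add: proxconj_output_def)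
  have split_huber: "(\<Sum>j<p. u $ j * huber M (\<alpha> $ j)) =
      (\<Sum>j\<in>J1. huber M (\<alpha> $ j)) + (\<Sum>i<n. u $ \<sigma> i * huber M (a i))"
    if "\<And>j. j \<in> J0 \<Longrightarrow> u $ j = 0" "\<And>j. j \<in> J1 \<Longrightarrow> u $ j = 1" for u
    unfolding sum_parts[OF \<sigma>] using that huber_\<sigma> by (simp add: n_def)
  have split_one: "(\<Sum>j<p. u $ j) = real (card J1) + (\<Sum>i<n. u $ \<sigma> i)"
    if "\<And>j. j \<in> J0 \<Longrightarrow> u $ j = 0" "\<And>j. j \<in> J1 \<Longrightarrow> u $ j = 1" for u
    unfolding sum_parts[OF \<sigma>] using that by (simp add: n_def)
  \<comment> \<open>With the constant function 1, \<open>ysum\<close> shows that the free part uses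
    \<open>min k' n\<close> of the budget left by \<open>J1\<close>.\<close>
  have "(\<Sum>j<p. z $ j) \<le> real k"
    using split_one[of z] zJ0 zJ1 z\<sigma> ysum[of "\<lambda>_. 1"] card by (simp add: k'_def of_nat_diff)
  moreover have "z $ j \<in> {0..1}" if "j \<in> Jf" for j
    using Jf_cases[OF that] z\<sigma> y01 by auto
  ultimately have zw: "z \<in> node_weights p k J0 J1 Jf"
    using zJ0 zJ1 by (simp add: node_weights_def z_def)
  have "\<beta> $ j - \<alpha> $ j = \<rho> * (z $ j * clip M (\<alpha> $ j))" if j: "j < p" for j
  proof -
    consider "j \<in> J0" | "j \<in> J1" | i where "i < n" "j = \<sigma> i"
      using j part Jf_cases by blast
    then show ?thesis
    proof cases
      case 1
      then show ?thesis using out zJ0 by (simp add: proxconj_output_def)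
    next
      case 2
      then have "\<alpha> $ j = prox_real (\<lambda>t. \<rho> * huber M t) (\<beta> $ j)"
        using out by (simp add: proxconj_output_def)
      then have "\<alpha> $ j + \<rho> * clip M (\<alpha> $ j) = \<beta> $ j"
        using prox_real_huber_stationary[OF M] \<rho> by simp
      then show ?thesis using zJ1[OF 2] by simp
    next
      case 3
      have "\<beta> $ j - \<alpha> $ j = sgn (\<beta> $ j) * (x i - a i)"
        using 3 x\<sigma>[OF 3(1)] \<alpha>\<sigma>[OF 3(1)] by (simp add: algebra_simps abs_mult_sgn)
      also have "\<dots> = \<rho> * (z $ j * (sgn (\<beta> $ j) * clip M (a i)))"
        unfolding stat[OF 3(1)] using z\<sigma>[OF 3(1)] 3 by simp
      also have "sgn (\<beta> $ j) * clip M (a i) = clip M (\<alpha> $ j)"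
        unfolding 3(2) \<alpha>\<sigma>[OF 3(1)] using 3(1) by (intro sg(1)[symmetric])
      finally show ?thesis .
    qed
  qed
  moreover have "(\<Sum>j<p. u $ j * huber M (\<alpha> $ j)) \<le> (\<Sum>j<p. z $ j * huber M (\<alpha> $ j))"
    if u: "u \<in> node_weights p k J0 J1 Jf" for u
  proof -
    have u0: "\<And>j. j \<in> J0 \<Longrightarrow> u $ j = 0" and u1: "\<And>j. j \<in> J1 \<Longrightarrow> u $ j = 1"
      and u01: "\<And>j. j \<in> Jf \<Longrightarrow> u $ j \<in> {0..1}" and uk: "(\<Sum>j<p. u $ j) \<le> real k"
      using u by (auto simp: node_weights_def)
    have "(\<Sum>i<n. u $ \<sigma> i) \<le> real k'"
      using uk split_one[OF u0 u1] card by (simp add: k'_def of_nat_diff)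
    \<comment> \<open>The Huber values inherit the decreasing order of \<open>a\<close>, so the
      knapsack bound applies, and \<open>ysum\<close> shows that \<open>z\<close> attains
      it.\<close>
    then have "(\<Sum>i<n. u $ \<sigma> i * huber M (a i)) \<le> (\<Sum>i<min k' n. huber M (a i))"
      using u01 \<sigma>Jf a0 a_dec huber_nonneg[OF M]
      by (intro weighted_sum_le_sum_prefix) (auto intro!: huber_mono[OF M])
    also have "\<dots> = (\<Sum>i<n. z $ \<sigma> i * huber M (a i))"
      unfolding ysum[symmetric] using z\<sigma> by (intro sum.cong) auto
    finally show ?thesis using split_huber[of u, OF u0 u1] split_huber[of z, OF zJ0 zJ1] by linarith
  qed
  ultimately have "certificate p k M J0 J1 Jf \<rho> \<beta> \<alpha> z"
    unfolding certificate_def[OF M part] using \<alpha> zw by blast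
  then show thesis by (rule that)
qed

section \<open>The program as a run of the algorithm\<close>

lemma filter_parts:
  "filter (\<lambda>j. j \<in> Jf) [0..<p] = sorted_list_of_set Jf"
  "set (filter (\<lambda>j. j \<in> J1) [0..<p]) = J1" "length (filter (\<lambda>j. j \<in> J1) [0..<p]) = card J1"
proof -
  show *: "set (filter (\<lambda>j. j \<in> J1) [0..<p]) = J1" using part by auto
  show "length (filter (\<lambda>j. j \<in> J1) [0..<p]) = card J1"
    using distinct_card[of "filter (\<lambda>j. j \<in> J1) [0..<p]"] * by simp
  have "sorted_list_of_set (set (filter (\<lambda>j. j \<in> Jf) [0..<p])) = filter (\<lambda>j. j \<in> Jf) [0..<p]"
    by (rule sorted_list_of_set.idem_if_sorted_distinct) (simp_all add: sorted_wrt_filter)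
  moreover have "set (filter (\<lambda>j. j \<in> Jf) [0..<p]) = Jf" using part by auto
  ultimately show "filter (\<lambda>j. j \<in> Jf) [0..<p] = sorted_list_of_set Jf" by simp
qed

lemma pava_tm_correct:
  assumes \<rho>: "\<rho> > 0" and xs: "length xs = n"
    and x: "\<And>i. i < n \<Longrightarrow> x i = fst (xs ! i)"
    and Bs: "Bs = val (pava_tm M (val (init_blocks_tm M \<rho> (k - card J1) 0 xs)))"
  shows "\<exists>a. (merge_step M (weight k J1 \<rho>) x)\<^sup>*\<^sup>*
      ((\<lambda>j. (j, j)) ` {..<n}, \<lambda>j. prox_real (\<lambda>t. weight k J1 \<rho> j * huber M t) (x j)) (block_intervals 0 Bs, a) \<and>
    (\<nexists>s. merge_step M (weight k J1 \<rho>) x (block_intervals 0 Bs, a) s) \<and>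
    val (expand_tm Bs) = map a [0..<n] \<and> total_len Bs = n"
proof -
  let ?w = "weight k J1 \<rho>" and ?a = "\<lambda>j. prox_real (\<lambda>t. weight k J1 \<rho> j * huber M t) (x j)"
  let ?Cs = "val (init_blocks_tm M \<rho> (k - card J1) 0 xs)"
  have w0: "\<And>j. ?w j \<ge> 0" using \<rho> by (simp add: weight_def)
  have init: "represents ?w x ?a 0 ?Cs" "block_intervals 0 ?Cs = (\<lambda>j. (j, j)) ` {..<n}" "total_len ?Cs = n"
    using represents_init_blocks_tm[of xs x 0 ?a M "k - card J1" \<rho>] xs x \<rho>
    by (simp_all add: weight_eq prox_huber_tm_correct[OF M] atLeast0LessThan)
  have "\<exists>a. (merge_step M ?w x)\<^sup>*\<^sup>* (block_intervals 0 ?Cs, ?a) (block_intervals 0 Bs, a) \<and> represents ?w x a 0 Bs \<and>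
      sorted_wrt (\<lambda>B C. bval C \<le> bval B) Bs \<and> total_len Bs = total_len ?Cs"
  proof (cases ?Cs)
    case Nil
    then show ?thesis using Bs by auto
  next
    case (Cons C Cs)
    then show ?thesis using scan_tm_correct[of ?w M x ?a "[]" C Cs] w0 M init(1) Bs by simp
  qed
  then obtain a where a: "(merge_step M ?w x)\<^sup>*\<^sup>* (block_intervals 0 ?Cs, ?a) (block_intervals 0 Bs, a)" "represents ?w x a 0 Bs"
    "sorted_wrt (\<lambda>B C. bval C \<le> bval B) Bs" "total_len Bs = n"
    using init by auto
  then show ?thesis
    using no_merge_step_if_sorted[OF a(2,3)] val_expand_tm[OF a(2)] init by auto
qed

lemma proxconj_tm_result:
  assumes \<rho>: "\<rho> > 0" and \<beta>: "\<beta> \<in> carrier_vec p"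
  shows "proxconj_result p k M J0 J1 Jf \<beta> \<rho> (val (proxconj_tm p k M J1 Jf \<beta> \<rho>))"
proof -
  define n where "n = card Jf"
  define ks where "ks = map (\<lambda>j. (\<bar>\<beta> $ j\<bar>, j)) (sorted_list_of_set Jf)"
  define xs where "xs = val (msort_desc_tm ks)"
  define Bs where "Bs = val (pava_tm M (val (init_blocks_tm M \<rho> (k - card J1) 0 xs)))"
  define \<alpha>1 where "\<alpha>1 = val (write_fixed_tm M \<rho> \<beta> (filter (\<lambda>j. j \<in> J1) [0..<p]) \<beta>)"
  define \<alpha> where "\<alpha> = val (write_free_tm \<beta> xs (val (expand_tm Bs)) \<alpha>1)"
  have val: "val (proxconj_tm p k M J1 Jf \<beta> \<rho>) = \<alpha>"
    unfolding proxconj_tm_def \<alpha>_def \<alpha>1_def Bs_def xs_def ks_def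
    by (simp add: members_tm keys_tm filter_parts)
  have n: "length ks = n" "length (sorted_list_of_set Jf) = n" by (simp_all add: ks_def n_def)
  \<comment> \<open>Sorting only preserves the multiset of keys; a permutation realizing it serves
    as the algorithm's \<open>\<pi>\<close>, however ties were broken.\<close>
  obtain \<pi> where \<pi>: "\<pi> permutes {..<n}" and "permute_list \<pi> ks = xs"
    using mset_eq_permutation[OF mset_msort_desc_tm[of ks]] n by (auto simp: xs_def)
  then have lxs: "length xs = n" and xsi: "\<And>i. i < n \<Longrightarrow> xs ! i = ks ! \<pi> i"
    using n by (auto simp: permute_list_nth)
  have \<pi>n: "\<pi> i < n" if "i < n" for i using permutes_in_image[OF \<pi>] that by auto
  have snd_xs: "snd (xs ! i) = sorted_list_of_set Jf ! \<pi> i" if "i < n" for i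
    using that \<pi>n n by (simp add: xsi ks_def)
  have sub: "subvec v Jf $ \<pi> i = v $ snd (xs ! i)" if "i < n" for v i
    using that \<pi> subvec_permutes by (simp add: snd_xs n_def)
  have fst_xs: "fst (xs ! i) = \<bar>subvec \<beta> Jf $ \<pi> i\<bar>" if "i < n" for i
    using that \<pi>n n sub by (simp add: xsi ks_def)
  have "sorting_perm Jf \<beta> \<pi>"
    unfolding sorting_perm_def n_def[symmetric]
  proof (intro conjI allI impI \<pi>)
    fix i j assume "i \<le> j" "j < n"
    then show "\<bar>subvec \<beta> Jf $ \<pi> j\<bar> \<le> \<bar>subvec \<beta> Jf $ \<pi> i\<bar>"
      using sorted_wrt_nth_less[OF sorted_msort_desc_tm[of ks], of i j] lxs
      by (cases "i = j") (auto simp: xs_def[symmetric] fst_xs)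
  qed
  moreover obtain a where
    "(loop_step k M J1 Jf \<beta> \<rho> \<pi>)\<^sup>*\<^sup>* (init_state k M J1 Jf \<beta> \<rho> \<pi>) (block_intervals 0 Bs, a)"
    "\<nexists>s. loop_step k M J1 Jf \<beta> \<rho> \<pi> (block_intervals 0 Bs, a) s"
    and vs: "val (expand_tm Bs) = map a [0..<n]"
    using pava_tm_correct[OF \<rho> lxs _ Bs_def, of "\<lambda>j. \<bar>subvec \<beta> Jf $ \<pi> j\<bar>"] fst_xs
    unfolding init_state_def n_def by auto
  moreover have "proxconj_output p M J0 J1 Jf \<beta> \<rho> \<pi> a \<alpha>"
  proof -
    have set_xs: "snd ` set xs = Jf"
    proof -
      have "set xs = set ks" using arg_cong[OF mset_msort_desc_tm[of ks], of set_mset] by (simp add: xs_def)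
      then show ?thesis using finite_parts by (simp add: ks_def image_image)
    qed
    have dist: "distinct (map snd xs)"
    proof -
      have "mset (map snd xs) = mset (map snd ks)" by (simp add: mset_msort_desc_tm xs_def)
      also have "map snd ks = sorted_list_of_set Jf" by (simp add: ks_def comp_def)
      finally show ?thesis using mset_eq_imp_distinct_iff by fastforce
    qed
    have Jp: "J0 \<subseteq> {..<p}" "J1 \<subseteq> {..<p}" "Jf \<subseteq> {..<p}" using part by auto
    have \<alpha>1: "\<alpha>1 $ j = (if j \<in> J1 then val (prox_huber_tm M \<rho> (\<beta> $ j)) else \<beta> $ j)" if "j < p" for j
      using write_fixed_tm_nth[OF \<beta> that, of M \<rho> \<beta> "filter (\<lambda>j. j \<in> J1) [0..<p]"]
      unfolding \<alpha>1_def filter_parts .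
    have \<alpha>1c: "\<alpha>1 \<in> carrier_vec p"
      unfolding \<alpha>1_def by (rule carrier_write_fixed_tm[OF \<beta>])
    have other: "\<alpha> $ j = \<alpha>1 $ j" if "j < p" "j \<notin> Jf" for j
      unfolding \<alpha>_def using that set_xs by (intro write_free_tm_other[OF \<alpha>1c]) auto
    have free: "subvec \<alpha> Jf $ \<pi> i = sgn (subvec \<beta> Jf $ \<pi> i) * a i" if "i < n" for i
      unfolding sub[OF that] \<alpha>_def using set_xs Jp(3) dist lxs vs that
      by (subst write_free_tm_nth[OF \<alpha>1c]) auto
    have "\<alpha> $ j = \<beta> $ j" if "j \<in> J0" for j
    proof -
      have "j < p" "j \<notin> J1" "j \<notin> Jf" using that Jp(1) disj(1,2) by blast+
      then show ?thesis using other[of j] \<alpha>1[of j] by simp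
    qed
    moreover have "\<alpha> $ j = prox_real (\<lambda>t. \<rho> * huber M t) (\<beta> $ j)" if "j \<in> J1" for j
    proof -
      have "j < p" "j \<notin> Jf" using that Jp(2) disj(3) by blast+
      then show ?thesis using that other[of j] \<alpha>1[of j] prox_huber_tm_correct[OF M, of \<rho>] \<rho> by simp
    qed
    moreover have "\<alpha> \<in> carrier_vec p" unfolding \<alpha>_def by (rule carrier_write_free_tm[OF \<alpha>1c])
    ultimately show ?thesis using free by (simp add: proxconj_output_def n_def)
  qed
  ultimately show ?thesis unfolding val proxconj_result_def by blast
qed

section \<open>Running time\<close>

lemma time_pava_tm: "time (pava_tm M Bs) \<le> 20 * length Bs + 5"
proof (cases Bs)
  case (Cons C Cs)
  then show ?thesis using time_scan_tm[of M "[]" C Cs] by simp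
qed simp

lemma time_proxconj_tm:
  assumes "p \<ge> 1" "\<rho> > 0"
  shows "real (time (proxconj_tm p k M J1 Jf \<beta> \<rho>)) \<le> 72 * (real p + real (card Jf) * ln (real (card Jf)))"
proof -
  define n where "n = card Jf"
  define ks where "ks = map (\<lambda>j. (\<bar>\<beta> $ j\<bar>, j)) (sorted_list_of_set Jf)"
  define xs where "xs = val (msort_desc_tm ks)"
  define Cs where "Cs = val (init_blocks_tm M \<rho> (k - card J1) 0 xs)"
  define Bs where "Bs = val (pava_tm M Cs)"
  define js1 where "js1 = filter (\<lambda>j. j \<in> J1) [0..<p]"
  define \<alpha>1 where "\<alpha>1 = val (write_fixed_tm M \<rho> \<beta> js1 \<beta>)"
  have lks: "length ks = n" by (simp add: ks_def n_def)
  have lxs: "length xs = n" using mset_eq_length[OF mset_msort_desc_tm[of ks]] lks by (simp add: xs_def)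
  have lCs: "length Cs = n"
    using represents_init_blocks_tm[of xs "\<lambda>i. fst (xs ! i)" 0
        "\<lambda>i. val (prox_huber_tm M (if i < k - card J1 then \<rho> else 0) (fst (xs ! i)))" M "k - card J1" \<rho>] lxs
    by (simp add: Cs_def)
  have lBs: "total_len Bs = n"
    using pava_tm_correct[OF assms(2) lxs _ Bs_def[unfolded Cs_def], of "\<lambda>i. fst (xs ! i)"] by auto
  have np: "n \<le> p" "card J1 \<le> p"
    using card_mono[of "{..<p}" Jf] card_mono[of "{..<p}" J1] part by (auto simp: n_def)
  have "time (proxconj_tm p k M J1 Jf \<beta> \<rho>) =
      time (members_tm J1 [0..<p]) + time (members_tm Jf [0..<p]) + (card J1 + 1) +
      time (keys_tm \<beta> (sorted_list_of_set Jf)) + time (msort_desc_tm ks) +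
      time (init_blocks_tm M \<rho> (k - card J1) 0 xs) + time (pava_tm M Cs) + time (expand_tm Bs) + p +
      time (write_fixed_tm M \<rho> \<beta> js1 \<beta>) + time (write_free_tm \<beta> xs (val (expand_tm Bs)) \<alpha>1)"
    unfolding proxconj_tm_def Bs_def Cs_def xs_def ks_def \<alpha>1_def js1_def
    by (simp add: members_tm(1) keys_tm(1) filter_parts)
  moreover have "time (members_tm J1 [0..<p]) \<le> 3 * p + 1" "time (members_tm Jf [0..<p]) \<le> 3 * p + 1"
    using members_tm(2)[of _ "[0..<p]"] by simp_all
  moreover have "time (keys_tm \<beta> (sorted_list_of_set Jf)) = 3 * n + 1" by (simp add: keys_tm n_def)
  moreover have "time (init_blocks_tm M \<rho> (k - card J1) 0 xs) \<le> 10 * n + 1"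
    using time_init_blocks_tm[of M \<rho> "k - card J1" 0 xs] lxs by simp
  moreover have "time (pava_tm M Cs) \<le> 20 * n + 5" using time_pava_tm[of Cs] lCs by simp
  moreover have "time (expand_tm Bs) = n + 1" using lBs by (simp add: time_expand_tm)
  moreover have "time (write_fixed_tm M \<rho> \<beta> js1 \<beta>) \<le> 9 * card J1 + 1"
    using time_write_fixed_tm[of M \<rho> \<beta> js1 \<beta>] by (simp add: js1_def filter_parts)
  moreover have "time (write_free_tm \<beta> xs (val (expand_tm Bs)) \<alpha>1) \<le> 5 * n + 1"
    using time_write_free_tm[of \<beta> xs "val (expand_tm Bs)" \<alpha>1] lxs by simp
  \<comment> \<open>Apart from sorting, the stages cost at most
    \<open>7 * p + 10 * card J1 + 39 * n + 13\<close>, which is below \<open>71 * p\<close>; the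
    additive 1 of sorting raises this to 72.\<close>
  ultimately have "time (proxconj_tm p k M J1 Jf \<beta> \<rho>) \<le> 71 * p + time (msort_desc_tm ks)"
    using np assms(1) by linarith
  then have "real (time (proxconj_tm p k M J1 Jf \<beta> \<rho>)) \<le> 71 * real p + real (time (msort_desc_tm ks))"
    by linarith
  moreover have "real (time (msort_desc_tm ks)) \<le> 1 + 18 * (real n * ln (real n))"
    using time_msort_desc_tm[of ks] lks by simp
  moreover have "0 \<le> real n * ln (real n)" by (cases "n = 0") auto
  ultimately show ?thesis using assms(1) unfolding n_def[symmetric] distrib_left by linarith
qed

end

theorem theorem4p5:
  shows "\<exists>C::real. \<forall>(p::nat) (k::nat) (M::real) (J0::nat set) (J1::nat set) (Jf::nat set).
    k \<in> {1..p} \<longrightarrow> M > 0 \<longrightarrow>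
    J0 \<union> J1 \<union> Jf = {..<p} \<longrightarrow> J0 \<inter> J1 = {} \<longrightarrow> J0 \<inter> Jf = {} \<longrightarrow> J1 \<inter> Jf = {} \<longrightarrow>
    card J1 \<le> k \<longrightarrow>
    (let g = g_node p k M J0 J1 Jf; gc = conj_fun p g in
     \<forall>\<beta>\<in>carrier_vec p. \<forall>\<rho>::real. \<rho> > 0 \<longrightarrow>
       \<comment> \<open>ProxConj computes the proximal operator of the conjugate, whatever choices it makes\<close>
       (\<exists>!\<gamma>. is_prox p (\<lambda>\<gamma>. ereal \<rho> * gc \<gamma>) \<beta> \<gamma>) \<and>
       proxconj_terminates k M J1 Jf \<beta> \<rho> \<and>
       (\<forall>\<alpha>. proxconj_result p k M J0 J1 Jf \<beta> \<rho> \<alpha> \<longrightarrow>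
            \<alpha> = prox p (\<lambda>\<gamma>. ereal \<rho> * gc \<gamma>) \<beta>) \<and>
       \<comment> \<open>the pool-adjacent-violators implementation is one of its runs, with the stated complexity\<close>
       proxconj_result p k M J0 J1 Jf \<beta> \<rho> (val (proxconj_tm p k M J1 Jf \<beta> \<rho>)) \<and>
       real (time (proxconj_tm p k M J1 Jf \<beta> \<rho>))
         \<le> C * (real p + real (card Jf) * ln (real (card Jf))) \<and>
       \<comment> \<open>the proximal operator of the function itself\<close>
       (\<exists>!\<gamma>. is_prox p (\<lambda>\<gamma>. ereal \<rho> * g \<gamma>) \<beta> \<gamma>) \<and>
       prox p (\<lambda>\<gamma>. ereal \<rho> * g \<gamma>) \<beta> =
         \<beta> - \<rho> \<cdot>\<^sub>v prox p (\<lambda>\<gamma>. ereal (inverse \<rho>) * gc \<gamma>) (inverse \<rho> \<cdot>\<^sub>v \<beta>) \<and>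
       (\<forall>\<alpha>. proxconj_result p k M J0 J1 Jf (inverse \<rho> \<cdot>\<^sub>v \<beta>) (inverse \<rho>) \<alpha> \<longrightarrow>
            prox p (\<lambda>\<gamma>. ereal \<rho> * g \<gamma>) \<beta> = \<beta> - \<rho> \<cdot>\<^sub>v \<alpha>))"
proof (rule exI[of _ 72], unfold Let_def, intro allI impI ballI)
  fix p k :: nat and M :: real and J0 J1 Jf :: "nat set" and \<beta> :: "real vec" and \<rho> :: real
  assume k: "k \<in> {1..p}" and M: "M > 0" and part: "J0 \<union> J1 \<union> Jf = {..<p}"
    and disj: "J0 \<inter> J1 = {}" "J0 \<inter> Jf = {}" "J1 \<inter> Jf = {}" and card: "card J1 \<le> k"
    and \<beta>: "\<beta> \<in> carrier_vec p" and \<rho>: "\<rho> > 0"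
  note A = M part disj card
  let ?g = "g_node p k M J0 J1 Jf"
  let ?gc = "conj_fun p ?g"
  \<comment> \<open>Every result has a certificate, and a certificate singles out the proximal
    point; hence all admissible choices lead to the same vector.\<close>
  have conj: "is_prox p (\<lambda>\<gamma>. ereal r * ?gc \<gamma>) b \<delta> \<longleftrightarrow> \<delta> = \<alpha>"
    if "proxconj_result p k M J0 J1 Jf b r \<alpha>" "b \<in> carrier_vec p" "r > 0" for b r \<alpha> \<delta>
    using certificate_exists[OF A that(3,1)] is_prox_conj_iff[OF M part that(2,3)] by metis
  have node: "is_prox p (\<lambda>\<gamma>. ereal \<rho> * ?g \<gamma>) \<beta> \<delta> \<longleftrightarrow> \<delta> = \<beta> - \<rho> \<cdot>\<^sub>v \<alpha>"
    if "proxconj_result p k M J0 J1 Jf (inverse \<rho> \<cdot>\<^sub>v \<beta>) (inverse \<rho>) \<alpha>" for \<alpha> \<delta>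
    using certificate_exists[OF A _ that] is_prox_g_node_iff[OF M part \<beta> \<rho>] \<rho>
    by (metis inverse_positive_iff_positive)
  have res: "proxconj_result p k M J0 J1 Jf \<beta> \<rho> (val (proxconj_tm p k M J1 Jf \<beta> \<rho>))"
    by (rule proxconj_tm_result[OF A \<rho> \<beta>])
  have \<rho>': "inverse \<rho> > 0" and \<beta>': "inverse \<rho> \<cdot>\<^sub>v \<beta> \<in> carrier_vec p" using \<rho> \<beta> by auto
  \<comment> \<open>The timed program provides a run for the rescaled data too, so existence of both
    proximal points is witnessed by actual results.\<close>
  note res' = proxconj_tm_result[OF A \<rho>' \<beta>']
  have time: "real (time (proxconj_tm p k M J1 Jf \<beta> \<rho>)) \<le> 72 * (real p + real (card Jf) * ln (real (card Jf)))"
    using k by (intro time_proxconj_tm[OF A _ \<rho>]) auto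
  have uniq: "\<exists>!\<gamma>. is_prox p (\<lambda>\<gamma>. ereal \<rho> * ?gc \<gamma>) \<beta> \<gamma>"
    unfolding conj[OF res \<beta> \<rho>] by simp
  have uniq': "\<exists>!\<gamma>. is_prox p (\<lambda>\<gamma>. ereal \<rho> * ?g \<gamma>) \<beta> \<gamma>"
    unfolding node[OF res'] by simp
  have all: "\<forall>\<alpha>. proxconj_result p k M J0 J1 Jf \<beta> \<rho> \<alpha> \<longrightarrow> \<alpha> = prox p (\<lambda>\<gamma>. ereal \<rho> * ?gc \<gamma>) \<beta>"
    using prox_eqI[OF conj[OF _ \<beta> \<rho>]] by metis
  have all': "\<forall>\<alpha>. proxconj_result p k M J0 J1 Jf (inverse \<rho> \<cdot>\<^sub>v \<beta>) (inverse \<rho>) \<alpha> \<longrightarrow>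
      prox p (\<lambda>\<gamma>. ereal \<rho> * ?g \<gamma>) \<beta> = \<beta> - \<rho> \<cdot>\<^sub>v \<alpha>"
    using prox_eqI[OF node] by metis
  \<comment> \<open>Both sides are expressed through the same result of the rescaled run.\<close>
  have moreau: "prox p (\<lambda>\<gamma>. ereal \<rho> * ?g \<gamma>) \<beta> =
      \<beta> - \<rho> \<cdot>\<^sub>v prox p (\<lambda>\<gamma>. ereal (inverse \<rho>) * ?gc \<gamma>) (inverse \<rho> \<cdot>\<^sub>v \<beta>)"
    unfolding prox_eqI[OF node[OF res']] prox_eqI[OF conj[OF res' \<beta>' \<rho>']] ..
  show "(\<exists>!\<gamma>. is_prox p (\<lambda>\<gamma>. ereal \<rho> * ?gc \<gamma>) \<beta> \<gamma>) \<and>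
       proxconj_terminates k M J1 Jf \<beta> \<rho> \<and>
       (\<forall>\<alpha>. proxconj_result p k M J0 J1 Jf \<beta> \<rho> \<alpha> \<longrightarrow>
            \<alpha> = prox p (\<lambda>\<gamma>. ereal \<rho> * ?gc \<gamma>) \<beta>) \<and>
       proxconj_result p k M J0 J1 Jf \<beta> \<rho> (val (proxconj_tm p k M J1 Jf \<beta> \<rho>)) \<and>
       real (time (proxconj_tm p k M J1 Jf \<beta> \<rho>))
         \<le> 72 * (real p + real (card Jf) * ln (real (card Jf))) \<and>
       (\<exists>!\<gamma>. is_prox p (\<lambda>\<gamma>. ereal \<rho> * ?g \<gamma>) \<beta> \<gamma>) \<and>
       prox p (\<lambda>\<gamma>. ereal \<rho> * ?g \<gamma>) \<beta> =
         \<beta> - \<rho> \<cdot>\<^sub>v prox p (\<lambda>\<gamma>. ereal (inverse \<rho>) * ?gc \<gamma>) (inverse \<rho> \<cdot>\<^sub>v \<beta>) \<and>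
       (\<forall>\<alpha>. proxconj_result p k M J0 J1 Jf (inverse \<rho> \<cdot>\<^sub>v \<beta>) (inverse \<rho>) \<alpha> \<longrightarrow>
            prox p (\<lambda>\<gamma>. ereal \<rho> * ?g \<gamma>) \<beta> = \<beta> - \<rho> \<cdot>\<^sub>v \<alpha>)"
    using uniq proxconj_terminates[OF A \<rho>] all res time uniq' moreau all' by blast
qed

end
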